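(* There exist numerical constants $c>0$ and $C>0$ such that for every $w\in A_\infty^+$ (not a.e. zero), $$\mathsf{C}_w^+(\alpha)-1\le C\,(1-\alpha)^{(c[w]_{A_\infty^+})^{-1}}\qquad\text{for all } \alpha \text{ with } 1>\alpha>1-e^{-c[w]_{A_\infty^+}}.$$ Furthermore, this estimate is optimal up to numerical constants, in the following sense: for every constant $K>0$ there exists a constant $C_K>0$, depending only on $K$, such that if $w$ is a non-negative locally integrable function on $\mathbb{R}$ and $\beta>1$ satisfy $$\mathsf{C}_w^+(\alpha)-1\le K(1-\alpha)^{1/\beta}\qquad\text{whenever } 1>\alpha>1-e^{-\beta},$$ then $w\in A_\infty^+$ and $[w]_{A_\infty^+}\le C_K\,\beta$.
   Context: A weight $w$ is a non-negative, locally integrable function on $\mathbb{R}$. Write $w(E)=\int_E w(t)\,dt$ for measurable $E\subseteq\mathbb{R}$ and $w(a,b)=\int_{(a,b)}w(t)\,dt$. The indicator function of $E$ is $\mathbf{1}_E$. For $f\in L^1_{\mathrm{loc}}(\mathbb{R})$ the forward and backward one-sided Hardy-Littlewood maximal operators are $$\mathsf{M}^+f(x)=\sup_{h>0}\frac1h\int_x^{x+h}|f(t)|\,dt,\qquad \mathsf{M}^-f(x)=\sup_{h>0}\frac1h\int_{x-h}^{x}|f(t)|\,dt,\qquad x\in\mathbb{R}.$$ The (Fujii-Wilson type) one-sided $A_\infty^+$ constant is $$[w]_{A_\infty^+}=\sup_{a<b}\frac{1}{w(a,b)}\int_{(a,b)}\mathsf{M}^-(w\mathbf{1}_{(a,b)})(x)\,dx,$$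 where intervals with $w(a,b)=0$ contribute $0$ (convention $0/0=0$), and $w\in A_\infty^+$ means $[w]_{A_\infty^+}<+\infty$. The sharp weighted tauberian constant of $\mathsf{M}^+$ is, for $\alpha\in(0,1)$, $$\mathsf{C}_w^+(\alpha)=\sup_{0<w(E)<+\infty}\frac{1}{w(E)}\,w(\{x\in\mathbb{R}:\mathsf{M}^+\mathbf{1}_E(x)>\alpha\}),$$ the supremum being over measurable sets $E\subseteq\mathbb{R}$ with $0<w(E)<+\infty$. A numerical constant is an absolute constant, independent of all parameters including $w$ and $\alpha$. *)

theory Defs
  imports "HOL-Analysis.Analysis"
begin

definition locally_integrable :: "(real \<Rightarrow> real) \<Rightarrow> bool" where
  "locally_integrable f \<longleftrightarrow> (\<forall>K. compact K \<longrightarrow> f absolutely_integrable_on K)"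

definition weight :: "(real \<Rightarrow> real) \<Rightarrow> bool" where
  "weight w \<longleftrightarrow> (\<forall>x. 0 \<le> w x) \<and> locally_integrable w"

definition wmass :: "(real \<Rightarrow> real) \<Rightarrow> real set \<Rightarrow> ennreal" where
  "wmass w E = (\<integral>\<^sup>+t\<in>E. ennreal (w t) \<partial>lebesgue)"

definition M_plus :: "(real \<Rightarrow> real) \<Rightarrow> real \<Rightarrow> ennreal" where
  "M_plus f x = (SUP h\<in>{0<..}. ennreal (1 / h) * (\<integral>\<^sup>+t\<in>{x..x + h}. ennreal \<bar>f t\<bar> \<partial>lebesgue))"

definition M_minus :: "(real \<Rightarrow> real) \<Rightarrow> real \<Rightarrow> ennreal" where
  "M_minus f x = (SUP h\<in>{0<..}. ennreal (1 / h) * (\<integral>\<^sup>+t\<in>{x - h..x}. ennreal \<bar>f t\<bar> \<partial>lebesgue))"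

(* On intervals with w(a,b) = 0 the integral vanishes as well, and 0 / 0 = 0 in ennreal,
   so such intervals contribute 0 to the supremum. *)
definition Ainf_plus_const :: "(real \<Rightarrow> real) \<Rightarrow> ennreal" where
  "Ainf_plus_const w =
    (SUP (a, b)\<in>{(a, b). a < b}.
      (\<integral>\<^sup>+x\<in>{a<..<b}. M_minus (\<lambda>t. w t * indicator {a<..<b} t) x \<partial>lebesgue)
        / wmass w {a<..<b})"

definition Ainf_plus :: "(real \<Rightarrow> real) set" where
  "Ainf_plus = {w. weight w \<and> Ainf_plus_const w < \<infinity>}"

(* If w vanishes almost everywhere, no set E is admissible and the supremum is 0. *)
definition tauberian_plus :: "(real \<Rightarrow> real) \<Rightarrow> real \<Rightarrow> ennreal" where
  "tauberian_plus w \<alpha> =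
    (SUP E\<in>{E \<in> sets lebesgue. 0 < wmass w E \<and> wmass w E < \<infinity>}.
      wmass w {x. M_plus (indicator E) x > ennreal \<alpha>} / wmass w E)"

end

theory Submission
  imports Defs
begin

text \<open>
  Everything is expressed through the local maximal function N_a(x), the supremum of the averages
  of w over [y,x] with a \<le> y < x. For a < x \<le> b it is the backward maximal function of w
  restricted to (a,b), so the one-sided constant A is the least constant such that the integral of
  N_a over (a,b) is at most A w(a,b).

  The engine is the rising sun lemma (level_set_component). If N_a(t) \<le> l, then on each component
  (p,q) of O_l = {x in (a,t). N_a(x) > l} the average of w is exactly l, the averages over (x,q) are
  at most l, and N_a = N_p. Hence w(O_l) = l |O_l|, and above the height l the
  integral of N_a is comparable to the sum of these masses over dyadic multiples of l. Such points t are found in every gap to the right of an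
  interval (exists_left_max_le). Both halves of the theorem pass through a quantitative decay of these
  masses: w(O_l) halves when l is multiplied by 2^n, with n comparable to A or to \<beta>.

  From A to the tauberian constant: applied on every component of O_l, the definition of A bounds the
  integral of N_a over O_l by A w(O_l); this forces the halving with n about 4 A
  (level_set_halving). As w is a.e. bounded by N_a, a subset of (a,b) whose measure is at most \<epsilon>
  times the gap c - b has mass at most a constant times \<epsilon>^(1/(2n)) w(a,c) (wmass_small_set_le,
  exists_dyadic_balance). On a component (p,q) of {M^+ 1_E > \<alpha>}, the complement of E fills at
  most the proportion 1 - \<alpha> of every (x,q). A Whitney decomposition towards q provides gaps,
  so the complement carries only a small proportion of the mass of the component, and this part is
  absorbed (wmass_tauberian_set_bounded_le).

  From the tauberian constant to A: testing with E = (p,q) minus F shows that a set F that is short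
  compared with the gap between it and q has little mass (wmass_small_set_le_of_tauberian). On a
  component of O_l this applies to the part of a much higher level set outside the last quarter, while the
  rising sun lemma controls the last quarter. So the masses halve with n comparable to \<beta>, and summing the
  dyadic levels bounds the integral of N_a over (a,b) by a multiple of \<beta> w(a,c), at the price of
  a gap (b,c). To remove the gap, (a,b) is decomposed into Whitney intervals towards b. The averages
  that reach too far back for the local bound are dominated by the integral of w(t)/(b - t)
  over (a,x), whose integral over x is w(a,b).
\<close>

section \<open>Mass of sets and decomposition of open sets into intervals\<close>

definition weight_measure :: "(real \<Rightarrow> real) \<Rightarrow> real measure" where
  "weight_measure w = density lebesgue (\<lambda>x. ennreal (w x))"

lemma weight_borel_measurable:
  assumes "weight w"
  shows "w \<in> borel_measurable lebesgue"
proof (rule borel_measurable_LIMSEQ_real)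
  show "(\<lambda>x. indicator {- real n..real n} x *\<^sub>R w x) \<in> borel_measurable lebesgue" for n
    using assms unfolding weight_def locally_integrable_def set_integrable_def
    by (metis borel_measurable_integrable compact_Icc)
  show "(\<lambda>n. indicator {- real n..real n} x *\<^sub>R w x) \<longlonglongrightarrow> w x" for x
  proof (rule tendsto_eventually)
    obtain N where "\<bar>x\<bar> \<le> real N" using real_arch_simple by blast
    then show "\<forall>\<^sub>F n in sequentially. indicator {- real n..real n} x *\<^sub>R w x = w x"
      by (intro eventually_sequentiallyI[of N]) (auto simp: indicator_def)
  qed
qed

lemma weight_measurable_ennreal:
  "weight w \<Longrightarrow> (\<lambda>x. ennreal (w x)) \<in> borel_measurable lebesgue"
  using weight_borel_measurable by measurable

lemma space_weight_measure [simp]: "space (weight_measure w) = UNIV"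
  and sets_weight_measure [simp]: "sets (weight_measure w) = sets lebesgue"
  by (auto simp: weight_measure_def)

lemma wmass_eq_emeasure:
  assumes "weight w" "E \<in> sets lebesgue"
  shows "wmass w E = emeasure (weight_measure w) E"
  using assms weight_measurable_ennreal[OF assms(1)]
  by (simp add: wmass_def weight_measure_def emeasure_density)

lemma wmass_mono: "E \<subseteq> F \<Longrightarrow> wmass w E \<le> wmass w F"
  unfolding wmass_def by (intro nn_integral_mono) (auto simp: indicator_def)

lemma wmass_empty [simp]: "wmass w {} = 0"
  by (simp add: wmass_def)

lemma wmass_Un:
  assumes "weight w" "E \<in> sets lebesgue" "F \<in> sets lebesgue" "E \<inter> F = {}"
  shows "wmass w (E \<union> F) = wmass w E + wmass w F"
  using assms by (simp add: wmass_eq_emeasure plus_emeasure)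

lemma wmass_subadditive:
  assumes "weight w" "E \<in> sets lebesgue" "F \<in> sets lebesgue"
  shows "wmass w (E \<union> F) \<le> wmass w E + wmass w F"
  using assms by (simp add: wmass_eq_emeasure emeasure_subadditive)

lemma wmass_cong_endpoints:
  assumes "E - {x, y} = F - {x, y}"
  shows "wmass w E = wmass w F"
  unfolding wmass_def
proof (rule nn_integral_cong_AE)
  have "AE t in lebesgue. t \<notin> {x, y}"
    by (intro AE_not_in null_sets_completionI) (auto intro: finite_imp_null_set_lborel)
  then show "AE t in lebesgue. ennreal (w t) * indicator E t = ennreal (w t) * indicator F t"
    by eventually_elim (use assms in \<open>auto simp: indicator_def\<close>)
qed

lemma wmass_interval_eq:
  "wmass w {x<..<y} = wmass w {x..y}" "wmass w {x..<y} = wmass w {x..y}" "wmass w {x<..y} = wmass w {x..y}"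
  by (auto intro!: wmass_cong_endpoints[of _ x y])

text \<open>
  Averages of w become difference quotients of a continuous monotone function, which turns all
  covering arguments below into statements about extrema of continuous functions on the line.
  The primitive is needed on one bounded window at a time, which spares a choice of sign convention
  for integrals to the left of an origin.
\<close>

lemma wmass_primitive:
  assumes "weight w"
  obtains F where "continuous_on {a..b} F"
    "\<And>x y. a \<le> x \<Longrightarrow> x \<le> y \<Longrightarrow> y \<le> b \<Longrightarrow> F x \<le> F y"
    "\<And>x y. a \<le> x \<Longrightarrow> x \<le> y \<Longrightarrow> y \<le> b \<Longrightarrow> wmass w {x..y} = ennreal (F y - F x)"
proof
  define F where "F x = integral {a..x} w" for x
  have abs: "w absolutely_integrable_on {x..y}" for x y
    using assms by (auto simp: weight_def locally_integrable_def)
  have int: "w integrable_on {x..y}" for x y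
    using abs set_lebesgue_integral_eq_integral(1) by blast
  have nn: "0 \<le> w x" for x using assms by (auto simp: weight_def)
  show "continuous_on {a..b} F" unfolding F_def
    using indefinite_integral_continuous_1[OF int] .
  have diff: "F y - F x = integral {x..y} w" if "a \<le> x" "x \<le> y" for x y
    unfolding F_def using Henstock_Kurzweil_Integration.integral_combine[OF that int] by simp
  show "F x \<le> F y" if "a \<le> x" "x \<le> y" "y \<le> b" for x y
    using diff[OF that(1,2)] integral_nonneg[OF int nn, of x y] by simp
  show "wmass w {x..y} = ennreal (F y - F x)" if "a \<le> x" "x \<le> y" "y \<le> b" for x y
  proof -
    have "wmass w {x..y} = (\<integral>\<^sup>+t. ennreal (indicator {x..y} t *\<^sub>R w t) \<partial>lebesgue)"
      unfolding wmass_def by (intro nn_integral_cong) (auto simp: indicator_def)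
    also have "\<dots> = ennreal (LINT t:{x..y}|lebesgue. w t)"
      unfolding set_lebesgue_integral_def
      using abs[of x y] nn by (intro nn_integral_eq_integral) (auto simp: set_integrable_def indicator_def)
    also have "(LINT t:{x..y}|lebesgue. w t) = F y - F x"
      using diff[OF that(1,2)] set_lebesgue_integral_eq_integral(2)[OF abs] by simp
    finally show ?thesis .
  qed
qed

lemma wmass_Icc_finite: "weight w \<Longrightarrow> wmass w {x..y} < \<infinity>"
  by (cases "x \<le> y", rule wmass_primitive[of w x y]) auto

lemma bounded_component_interval:
  fixes U :: "real set"
  assumes "open U" "bounded U" "S \<in> components U"
  obtains p q where "p < q" "S = {p<..<q}" "p \<notin> U" "q \<notin> U"
proof -
  have S: "open S" "connected S" "S \<noteq> {}" "S \<subseteq> U"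
    using open_components[OF assms(1,3)] in_components_connected[OF assms(3)]
      in_components_nonempty[OF assms(3)] in_components_subset[OF assms(3)] by auto
  have bd: "bounded S" using S assms bounded_subset by blast
  define p where "p = Inf S"
  define q where "q = Sup S"
  have bdd: "bdd_below S" "bdd_above S" using bd bounded_imp_bdd_below bounded_imp_bdd_above by auto
  have sub: "S \<subseteq> {p<..<q}"
  proof
    fix x assume x: "x \<in> S"
    then obtain e where e: "e > 0" "ball x e \<subseteq> S" using S openE by blast
    have "x - e/2 \<in> S" "x + e/2 \<in> S" using e by (auto simp: subset_iff dist_real_def)
    then have "p \<le> x - e/2" "x + e/2 \<le> q"
      unfolding p_def q_def using bdd by (auto intro: cInf_lower cSup_upper)
    then show "x \<in> {p<..<q}" using e by auto
  qed
  have sup: "{p<..<q} \<subseteq> S"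
  proof
    fix x assume x: "x \<in> {p<..<q}"
    obtain u where u: "u \<in> S" "u < x" using x S(3) bdd unfolding p_def by (auto simp: cInf_less_iff)
    obtain v where v: "v \<in> S" "x < v" using x S(3) bdd unfolding q_def by (auto simp: less_cSup_iff)
    show "x \<in> S" using S(2) u v unfolding connected_iff_interval by (meson less_imp_le)
  qed
  have eq: "S = {p<..<q}" using sub sup by auto
  have pq: "p < q" using S(3) eq by (metis greaterThanLessThan_empty_iff not_le)
  have edge: "z \<notin> U" if z: "z = p \<or> z = q" for z
  proof
    assume "z \<in> U"
    have "connected (insert z S)"
      by (rule connected_intermediate_closure[OF S(2)]) (use z pq in \<open>auto simp: eq\<close>)
    then have "insert z S \<subseteq> S"
      using components_maximal[OF assms(3), of "insert z S"] S \<open>z \<in> U\<close> by auto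
    then show False using z eq by auto
  qed
  show thesis using that[OF pq eq] edge by auto
qed

text \<open>
  Every estimate on a superlevel set of a maximal function is proved on one component and then
  summed over the countably many components, which are bounded open intervals.
\<close>

lemma set_nn_integral_le_by_components:
  fixes U :: "real set" and g h :: "real \<Rightarrow> ennreal"
  assumes U: "open U" "bounded U"
    and g: "g \<in> borel_measurable lebesgue" and h: "h \<in> borel_measurable lebesgue"
    and le: "\<And>p q. p < q \<Longrightarrow> {p<..<q} \<subseteq> U \<Longrightarrow> p \<notin> U \<Longrightarrow> q \<notin> U \<Longrightarrow>
      (\<integral>\<^sup>+x\<in>{p<..<q}. g x \<partial>lebesgue) \<le> C * (\<integral>\<^sup>+x\<in>{p<..<q}. h x \<partial>lebesgue)"
  shows "(\<integral>\<^sup>+x\<in>U. g x \<partial>lebesgue) \<le> C * (\<integral>\<^sup>+x\<in>U. h x \<partial>lebesgue)"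
proof -
  let ?I = "components U"
  have op: "open S" if "S \<in> ?I" for S using that U open_components by blast
  have disj: "disjoint_family_on (\<lambda>S. S) ?I"
    using components_nonoverlap unfolding disjoint_family_on_def by blast
  have cnt: "countable ?I"
    using countable_disjoint_open_subsets[of ?I] op components_nonoverlap
    by (metis disjointI)
  have sum: "(\<integral>\<^sup>+x\<in>U. f x \<partial>lebesgue) = (\<integral>\<^sup>+S. (\<integral>\<^sup>+x\<in>S. f x \<partial>lebesgue) \<partial>count_space ?I)"
    if f: "f \<in> borel_measurable lebesgue" for f :: "real \<Rightarrow> ennreal"
  proof -
    have "(\<integral>\<^sup>+x\<in>U. f x \<partial>lebesgue) = emeasure (density lebesgue f) (\<Union>S\<in>?I. S)"
      using f U by (simp add: emeasure_density Union_components)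
    also have "\<dots> = (\<integral>\<^sup>+S. emeasure (density lebesgue f) S \<partial>count_space ?I)"
      by (rule emeasure_UN_countable) (use cnt disj op in auto)
    also have "\<dots> = (\<integral>\<^sup>+S. (\<integral>\<^sup>+x\<in>S. f x \<partial>lebesgue) \<partial>count_space ?I)"
      using f op by (intro nn_integral_cong) (simp add: emeasure_density)
    finally show ?thesis .
  qed
  have "(\<integral>\<^sup>+x\<in>U. g x \<partial>lebesgue) \<le> (\<integral>\<^sup>+S. C * (\<integral>\<^sup>+x\<in>S. h x \<partial>lebesgue) \<partial>count_space ?I)"
    unfolding sum[OF g]
  proof (rule nn_integral_mono)
    fix S assume "S \<in> space (count_space ?I)"
    then obtain p q where "p < q" "S = {p<..<q}" "p \<notin> U" "q \<notin> U" "S \<subseteq> U"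
      using bounded_component_interval[OF U] in_components_subset by (metis space_count_space)
    then show "(\<integral>\<^sup>+x\<in>S. g x \<partial>lebesgue) \<le> C * (\<integral>\<^sup>+x\<in>S. h x \<partial>lebesgue)"
      using le by auto
  qed
  also have "\<dots> = C * (\<integral>\<^sup>+x\<in>U. h x \<partial>lebesgue)"
    unfolding sum[OF h] by (rule nn_integral_cmult) auto
  finally show ?thesis .
qed

section \<open>The local backward maximal function and the rising sun lemma\<close>

text \<open>
  The local maximal function with left endpoint a. Unlike the restriction of the weight to (a,b) in
  the definition of the constant, it does not mention b; passing from an interval to a subinterval
  with the same left endpoint therefore changes nothing.
\<close>

definition left_max :: "(real \<Rightarrow> real) \<Rightarrow> real \<Rightarrow> real \<Rightarrow> ennreal" where
  "left_max w a x = (SUP y\<in>{a..<x}. wmass w {y..x} / ennreal (x - y))"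

text \<open>
  The restricted weight vanishes to the left of a, so the average over an interval that starts
  before a only grows when the interval is cut at a: the mass stays and the length shrinks.
\<close>

lemma M_minus_restrict_eq_left_max:
  assumes w: "weight w" and x: "a < x" "x \<le> b"
  shows "M_minus (\<lambda>t. w t * indicator {a<..<b} t) x = left_max w a x"
proof (rule antisym)
  have nn: "0 \<le> w t" for t using w by (auto simp: weight_def)
  let ?f = "\<lambda>t. w t * indicator {a<..<b} t"
  show "M_minus ?f x \<le> left_max w a x"
    unfolding M_minus_def
  proof (rule SUP_least)
    fix h :: real assume "h \<in> {0<..}"
    then have h: "h > 0" by simp
    define y where "y = max a (x - h)"
    have y: "y \<in> {a..<x}" "0 < x - y" "x - y \<le> h" using x h by (auto simp: y_def)
    have "(\<integral>\<^sup>+t\<in>{x - h..x}. ennreal \<bar>?f t\<bar> \<partial>lebesgue) \<le> wmass w {y..x}"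
      unfolding wmass_def using nn by (intro nn_integral_mono) (auto simp: indicator_def y_def)
    then have "ennreal (1 / h) * (\<integral>\<^sup>+t\<in>{x - h..x}. ennreal \<bar>?f t\<bar> \<partial>lebesgue)
        \<le> ennreal (1 / (x - y)) * wmass w {y..x}"
      using y h by (intro mult_mono ennreal_leI divide_left_mono) auto
    also have "\<dots> = wmass w {y..x} / ennreal (x - y)"
      using y by (simp add: divide_ennreal_def mult.commute inverse_ennreal inverse_eq_divide)
    also have "\<dots> \<le> left_max w a x" unfolding left_max_def using y by (intro SUP_upper) auto
    finally show "ennreal (1 / h) * (\<integral>\<^sup>+t\<in>{x - h..x}. ennreal \<bar>?f t\<bar> \<partial>lebesgue) \<le> left_max w a x" .
  qed
  show "left_max w a x \<le> M_minus ?f x"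
    unfolding left_max_def
  proof (rule SUP_least)
    fix y assume y: "y \<in> {a..<x}"
    have "wmass w {y..x} = wmass w {y<..<x}" by (simp add: wmass_interval_eq)
    also have "\<dots> \<le> (\<integral>\<^sup>+t\<in>{x - (x - y)..x}. ennreal \<bar>?f t\<bar> \<partial>lebesgue)"
      unfolding wmass_def using nn x y by (intro nn_integral_mono) (auto simp: indicator_def)
    finally have "ennreal (1 / (x - y)) * wmass w {y..x}
        \<le> ennreal (1 / (x - y)) * (\<integral>\<^sup>+t\<in>{x - (x - y)..x}. ennreal \<bar>?f t\<bar> \<partial>lebesgue)"
      by (intro mult_left_mono) auto
    also have "\<dots> \<le> M_minus ?f x"
      unfolding M_minus_def using y by (intro SUP_upper) auto
    finally show "wmass w {y..x} / ennreal (x - y) \<le> M_minus ?f x"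
      using y by (simp add: divide_ennreal_def mult.commute inverse_ennreal inverse_eq_divide)
  qed
qed

lemma less_left_max_iff:
  assumes "weight w" "0 \<le> l"
  shows "ennreal l < left_max w a x \<longleftrightarrow> (\<exists>y\<in>{a..<x}. ennreal (l * (x - y)) < wmass w {y..x})"
  unfolding left_max_def less_SUP_iff
proof (rule bex_cong[OF refl])
  fix y assume y: "y \<in> {a..<x}"
  obtain m where m: "wmass w {y..x} = ennreal m" "0 \<le> m"
    using wmass_Icc_finite[OF assms(1), of y x] by (cases "wmass w {y..x}") auto
  show "ennreal l < wmass w {y..x} / ennreal (x - y) \<longleftrightarrow> ennreal (l * (x - y)) < wmass w {y..x}"
    using m y assms(2) by (simp add: divide_ennreal ennreal_less_iff pos_less_divide_eq)
qed

lemma left_max_le_iff: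
  assumes "weight w" "0 \<le> l"
  shows "left_max w a x \<le> ennreal l \<longleftrightarrow> (\<forall>y\<in>{a..<x}. wmass w {y..x} \<le> ennreal (l * (x - y)))"
  using less_left_max_iff[OF assms] by (meson leD not_le)

lemma left_max_zero_mass:
  assumes "wmass w {a..b} = 0" "x \<le> b"
  shows "left_max w a x = 0"
proof -
  have "wmass w {y..x} = 0" if "a \<le> y" for y
    using wmass_mono[of "{y..x}" "{a..b}" w] assms that by auto
  then show ?thesis unfolding left_max_def by (auto intro!: antisym SUP_least)
qed

definition level_set :: "(real \<Rightarrow> real) \<Rightarrow> real \<Rightarrow> real \<Rightarrow> real \<Rightarrow> real set" where
  "level_set w a t l = {x \<in> {a<..<t}. ennreal l < left_max w a x}"

lemma level_set_subset: "level_set w a t l \<subseteq> {a<..<t}"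
  by (auto simp: level_set_def)

lemma bounded_level_set: "bounded (level_set w a t l)"
  by (rule bounded_subset[OF _ level_set_subset]) simp

lemma level_set_antimono: "l \<le> l' \<Longrightarrow> level_set w a t l' \<subseteq> level_set w a t l"
  unfolding level_set_def using ennreal_leI le_less_trans by blast

lemma open_level_set:
  assumes w: "weight w" and l: "0 \<le> l"
  shows "open (level_set w a t l)"
proof -
  obtain F where F: "continuous_on {a..t} F"
    "\<And>x y. a \<le> x \<Longrightarrow> x \<le> y \<Longrightarrow> y \<le> t \<Longrightarrow> F x \<le> F y"
    "\<And>x y. a \<le> x \<Longrightarrow> x \<le> y \<Longrightarrow> y \<le> t \<Longrightarrow> wmass w {x..y} = ennreal (F y - F x)"
    using wmass_primitive[OF w, of a t] by blast
  have "open ((\<lambda>z. F z - F y - l * (z - y)) -` {0<..} \<inter> {y<..<t})" if "a \<le> y" for y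
    using that by (intro continuous_on_open_vimage[THEN iffD1, rule_format])
       (auto intro!: continuous_intros intro: continuous_on_subset[OF F(1)])
  moreover have "level_set w a t l = (\<Union>y\<in>{a..}. (\<lambda>z. F z - F y - l * (z - y)) -` {0<..} \<inter> {y<..<t})"
    using l F(2) by (fastforce simp: level_set_def less_left_max_iff[OF w l] F(3) ennreal_less_iff)
  ultimately show ?thesis by auto
qed

lemma left_max_measurable:
  assumes w: "weight w"
  shows "(\<lambda>x. left_max w a x * indicator {a<..<t} x) \<in> borel_measurable lebesgue"
proof (rule borel_measurableI_greater)
  fix y :: ennreal
  show "{x \<in> space lebesgue. y < left_max w a x * indicator {a<..<t} x} \<in> sets lebesgue"
  proof (cases y)
    case (real r)
    then have "{x \<in> space lebesgue. y < left_max w a x * indicator {a<..<t} x} = level_set w a t r"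
      by (auto simp: level_set_def indicator_def split: if_splits)
    then show ?thesis using open_level_set[OF w, of r a t] real by simp
  qed simp
qed

text \<open>
  A weak type (1,1) statement without any covering: with F a primitive of w, take t to be a minimum
  point of F(x) - l x on [b,c]. No average of w over an interval ending at t exceeds l. For intervals
  starting in [b,t] this is minimality; for those starting before b it holds because the value at c,
  and hence at t, is below all values on [a,b] once l (c - b) dominates the mass of [a,c].
\<close>

lemma exists_left_max_le:
  assumes w: "weight w" and abc: "a < b" "b < c" and l: "0 \<le> l"
    and le: "wmass w {a..c} \<le> ennreal (l * (c - b))"
  obtains t where "b \<le> t" "t \<le> c" "left_max w a t \<le> ennreal l"
proof -
  obtain F where F: "continuous_on {a..c} F"
    "\<And>x y. a \<le> x \<Longrightarrow> x \<le> y \<Longrightarrow> y \<le> c \<Longrightarrow> F x \<le> F y"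
    "\<And>x y. a \<le> x \<Longrightarrow> x \<le> y \<Longrightarrow> y \<le> c \<Longrightarrow> wmass w {x..y} = ennreal (F y - F x)"
    using wmass_primitive[OF w, of a c] by blast
  have "continuous_on {b..c} (\<lambda>x. F x - l * x)"
    using abc by (intro continuous_intros continuous_on_subset[OF F(1)]) auto
  then obtain t where t: "t \<in> {b..c}" "\<And>y. y \<in> {b..c} \<Longrightarrow> F t - l * t \<le> F y - l * y"
    using continuous_attains_inf[of "{b..c}" "\<lambda>x. F x - l * x"] abc by auto
  have "F t - l * t \<le> F y - l * y" if y: "y \<in> {a..<t}" for y
  proof (cases "b \<le> y")
    case True then show ?thesis using t y by auto
  next
    case False
    have "F c - F a \<le> l * (c - b)"
      using le abc l F(2)[of a c] by (simp add: F(3))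
    moreover have "F a \<le> F y" using F(2)[of a y] y t abc by auto
    moreover have "l * (c - b) \<le> l * (c - y)" using False l by (intro mult_left_mono) auto
    moreover have "F t - l * t \<le> F c - l * c" using t(2)[of c] abc by auto
    ultimately show ?thesis by (simp add: algebra_simps)
  qed
  then have "left_max w a t \<le> ennreal l"
    using t abc l F(2,3) by (auto simp: left_max_le_iff[OF w l] algebra_simps intro!: ennreal_leI)
  then show thesis using that t by auto
qed

text \<open>
  The rising sun lemma on (a,t). Put G(x) = F(x) - l x with F a primitive of w. A point lies in the
  level set iff some earlier value of G is smaller. At the right end q of a component no earlier
  value is smaller, so averages over (x,q) are at most l; inside the component G never drops below
  G(p), since before a minimum point over [p,x] other than p there would be a smaller value, necessarily before
  p, against p being outside. Together G(p) = G(q). The assumption on t makes all components end inside [a,t].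
  Localization, the third claim, holds because averages across p are weighted means of an average
  over an interval ending at p, which is at most l, and one over (p,x), which is at least l.
\<close>

lemma level_set_component:
  assumes w: "weight w" and l: "0 \<le> l" and at: "a < t" and t: "left_max w a t \<le> ennreal l"
    and pq: "p < q" "{p<..<q} \<subseteq> level_set w a t l" "p \<notin> level_set w a t l" "q \<notin> level_set w a t l"
  shows "wmass w {p..q} = ennreal (l * (q - p))"
    and "\<And>x. p \<le> x \<Longrightarrow> x \<le> q \<Longrightarrow> wmass w {x..q} \<le> ennreal (l * (q - x))"
    and "\<And>x. x \<in> {p<..<q} \<Longrightarrow> left_max w a x = left_max w p x"
    and "a \<le> p" "q \<le> t"
proof -
  have sub: "{p<..<q} \<subseteq> {a<..<t}" using pq(2) level_set_subset by blast
  show ap: "a \<le> p" and qt: "q \<le> t" using sub pq(1) by (auto simp: greaterThanLessThan_subseteq_greaterThanLessThan)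
  obtain F where F: "continuous_on {a..t} F"
    "\<And>x y. a \<le> x \<Longrightarrow> x \<le> y \<Longrightarrow> y \<le> t \<Longrightarrow> F x \<le> F y"
    "\<And>x y. a \<le> x \<Longrightarrow> x \<le> y \<Longrightarrow> y \<le> t \<Longrightarrow> wmass w {x..y} = ennreal (F y - F x)"
    using wmass_primitive[OF w, of a t] by blast
  define G where "G x = F x - l * x" for x
  have contG: "continuous_on {a..t} G" unfolding G_def by (intro continuous_intros F(1))
  have notin: "G x \<le> G y" if "x \<notin> level_set w a t l" "a \<le> y" "y < x" "x \<le> t" for x y
  proof -
    have "left_max w a x \<le> ennreal l"
      using that t by (cases "x = t") (auto simp: level_set_def not_less)
    then have "wmass w {y..x} \<le> ennreal (l * (x - y))"
      using that by (auto simp: left_max_le_iff[OF w l])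
    then have "F x - F y \<le> l * (x - y)"
      using that F(3)[of y x] l by (simp add: ennreal_le_iff)
    then show ?thesis by (simp add: G_def algebra_simps)
  qed
  have inn: "\<exists>y\<in>{a..<x}. G y < G x" if x: "x \<in> level_set w a t l" for x
  proof -
    obtain y where y: "y \<in> {a..<x}" "ennreal (l * (x - y)) < wmass w {y..x}"
      using x unfolding level_set_def mem_Collect_eq less_left_max_iff[OF w l] by blast
    moreover have "x \<le> t" using x level_set_subset[of w a t l] by fastforce
    ultimately have "l * (x - y) < F x - F y"
      using F(3)[of y x] l by (simp add: ennreal_less_iff)
    then have "G y < G x" by (simp add: G_def algebra_simps)
    then show ?thesis using y(1) by blast
  qed
  have Gp: "G p \<le> G x" if x: "x \<in> {p<..<q}" for x
  proof -
    have "continuous_on {p..x} G" using x ap qt by (intro continuous_on_subset[OF contG]) auto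
    then obtain z where z: "z \<in> {p..x}" "\<And>y. y \<in> {p..x} \<Longrightarrow> G z \<le> G y"
      using continuous_attains_inf[of "{p..x}" G] x by auto
    have "z = p"
    proof (rule ccontr)
      assume "z \<noteq> p"
      then have "z \<in> {p<..<q}" using z x by auto
      then obtain y where y: "y \<in> {a..<z}" "G y < G z" using inn pq(2) by blast
      have "y < p" using z(1) z(2)[of y] y by force
      then have "G p \<le> G y" using notin[OF pq(3)] y ap pq(1) qt by auto
      then show False using y z(2)[of p] x by auto
    qed
    then show ?thesis using z x by auto
  qed
  have Gpq: "G p \<le> G q"
  proof (rule continuous_ge_on_closure[of "{p<..<q}" G q "G p"])
    show "continuous_on (closure {p<..<q}) G"
      using pq(1) ap qt by (auto intro!: continuous_on_subset[OF contG])
  qed (use pq(1) Gp in auto)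
  have Gq: "G q \<le> G x" if "p \<le> x" "x \<le> q" for x
    using notin[OF pq(4), of x] that ap qt by (cases "x = q") auto
  show "wmass w {p..q} = ennreal (l * (q - p))"
  proof -
    have "G p = G q" using Gpq Gq[of p] pq(1) by auto
    then have "F q - F p = l * (q - p)" by (simp add: G_def algebra_simps)
    then show ?thesis using ap qt pq(1) by (simp add: F(3))
  qed
  show "wmass w {x..q} \<le> ennreal (l * (q - x))" if "p \<le> x" "x \<le> q" for x
    using Gq[OF that] that ap qt by (simp add: F(3) G_def algebra_simps ennreal_leI)
  show "left_max w a x = left_max w p x" if x: "x \<in> {p<..<q}" for x
  proof (rule antisym)
    show "left_max w p x \<le> left_max w a x"
      unfolding left_max_def using ap by (intro SUP_subset_mono) auto
    show "left_max w a x \<le> left_max w p x"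
      unfolding left_max_def[of w a x]
    proof (rule SUP_least)
      fix y assume y: "y \<in> {a..<x}"
      have base: "wmass w {z..x} / ennreal (x - z) \<le> left_max w p x" if "z \<in> {p..<x}" for z
        unfolding left_max_def using that by (intro SUP_upper)
      show "wmass w {y..x} / ennreal (x - y) \<le> left_max w p x"
      proof (cases "p \<le> y")
        case True then show ?thesis using base y by auto
      next
        case False
        have "G p \<le> G y" using notin[OF pq(3)] False y pq(1) qt by auto
        then have 1: "F p - F y \<le> l * (p - y)" by (simp add: G_def algebra_simps)
        have 2: "l * (x - p) \<le> F x - F p" using Gp[OF x] by (simp add: G_def algebra_simps)
        have "(F p - F y) * (x - p) \<le> (l * (p - y)) * (x - p)"
          using 1 x by (intro mult_right_mono) auto
        also have "\<dots> = (l * (x - p)) * (p - y)" by simp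
        also have "\<dots> \<le> (F x - F p) * (p - y)" using 2 False by (intro mult_right_mono) auto
        finally have "(F x - F y) / (x - y) \<le> (F x - F p) / (x - p)"
          using False x by (simp add: divide_simps algebra_simps)
        then have "wmass w {y..x} / ennreal (x - y) \<le> wmass w {p..x} / ennreal (x - p)"
          using False x y ap qt F(2)[of y x] F(2)[of p x]
          by (simp add: F(3) divide_ennreal ennreal_leI)
        also have "\<dots> \<le> left_max w p x" using base x by auto
        finally show ?thesis .
      qed
    qed
  qed
qed

lemma wmass_level_set:
  assumes w: "weight w" and l: "0 \<le> l" and at: "a < t" and t: "left_max w a t \<le> ennreal l"
  shows "wmass w (level_set w a t l) = ennreal l * emeasure lebesgue (level_set w a t l)"
proof (rule antisym)
  let ?O = "level_set w a t l"
  note op = open_level_set[OF w l, of a t] bounded_level_set[of w a t l]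
  have int: "(\<integral>\<^sup>+x\<in>A. ennreal c \<partial>lebesgue) = ennreal c * emeasure lebesgue A"
    if "A \<in> sets lebesgue" for c and A :: "real set"
    using that by (simp add: nn_integral_cmult_indicator)
  have "(\<integral>\<^sup>+x\<in>?O. ennreal (w x) \<partial>lebesgue) \<le> ennreal l * (\<integral>\<^sup>+x\<in>?O. 1 \<partial>lebesgue)"
  proof (rule set_nn_integral_le_by_components[OF op weight_measurable_ennreal[OF w]])
    fix p q assume pq: "p < q" "{p<..<q} \<subseteq> ?O" "p \<notin> ?O" "q \<notin> ?O"
    have "wmass w {p<..<q} = ennreal l * ennreal (q - p)"
      using level_set_component(1)[OF w l at t pq] pq(1) l by (simp add: wmass_interval_eq ennreal_mult)
    then show "(\<integral>\<^sup>+x\<in>{p<..<q}. ennreal (w x) \<partial>lebesgue) \<le> ennreal l * (\<integral>\<^sup>+x\<in>{p<..<q}. 1 \<partial>lebesgue)"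
      using pq(1) by (simp add: wmass_def)
  qed simp
  then show "wmass w ?O \<le> ennreal l * emeasure lebesgue ?O"
    using op(1) by (simp add: wmass_def)
  have "(\<integral>\<^sup>+x\<in>?O. ennreal l \<partial>lebesgue) \<le> 1 * (\<integral>\<^sup>+x\<in>?O. ennreal (w x) \<partial>lebesgue)"
  proof (rule set_nn_integral_le_by_components[OF op _ weight_measurable_ennreal[OF w]])
    fix p q assume pq: "p < q" "{p<..<q} \<subseteq> ?O" "p \<notin> ?O" "q \<notin> ?O"
    have "wmass w {p<..<q} = ennreal l * ennreal (q - p)"
      using level_set_component(1)[OF w l at t pq] pq(1) l by (simp add: wmass_interval_eq ennreal_mult)
    then show "(\<integral>\<^sup>+x\<in>{p<..<q}. ennreal l \<partial>lebesgue) \<le> 1 * (\<integral>\<^sup>+x\<in>{p<..<q}. ennreal (w x) \<partial>lebesgue)"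
      using pq(1) by (simp add: wmass_def int)
  qed simp
  then show "ennreal l * emeasure lebesgue ?O \<le> wmass w ?O"
    using op(1) by (simp add: wmass_def int)
qed

text \<open>
  This replaces the Lebesgue differentiation theorem. Cover E by an open set V of nearly the same
  measure. In a component (u,v) of V let s be the supremum of the part of E in it: the mass of that
  part is at most the mass of (u,s), and s is a limit of points of E, so the average over (u,s)
  is at most l.
\<close>

lemma wmass_le_where_left_max_le:
  assumes w: "weight w" and l: "0 \<le> l" and E: "E \<in> sets lebesgue" "E \<subseteq> {a<..<b}"
    and le: "\<And>x. x \<in> E \<Longrightarrow> left_max w a x \<le> ennreal l"
  shows "wmass w E \<le> ennreal l * emeasure lebesgue E"
proof (rule ennreal_le_epsilon)
  fix e :: real assume e: "e > 0"
  \<comment> \<open>The denominator is l + 1 rather than l to cover l = 0.\<close>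
  define d where "d = e / (l + 1)"
  have d: "d > 0" "l * d \<le> e" using e l by (auto simp: d_def field_simps)
  obtain V where V: "open V" "E \<subseteq> V" "emeasure lebesgue (V - E) < ennreal d"
    using sets_lebesgue_outer_open[OF E(1) d(1)] by (metis)
  define U where "U = V \<inter> {a<..<b}"
  have U: "open U" "bounded U" "E \<subseteq> U" using V E by (auto simp: U_def bounded_Int)
  obtain F where F: "continuous_on {a..b} F"
    "\<And>x y. a \<le> x \<Longrightarrow> x \<le> y \<Longrightarrow> y \<le> b \<Longrightarrow> F x \<le> F y"
    "\<And>x y. a \<le> x \<Longrightarrow> x \<le> y \<Longrightarrow> y \<le> b \<Longrightarrow> wmass w {x..y} = ennreal (F y - F x)"
    using wmass_primitive[OF w, of a b] by blast
  have "(\<integral>\<^sup>+x\<in>U. ennreal (w x) * indicator E x \<partial>lebesgue) \<le> ennreal l * (\<integral>\<^sup>+x\<in>U. 1 \<partial>lebesgue)"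
  proof (rule set_nn_integral_le_by_components[OF U(1,2)])
    show "(\<lambda>x. ennreal (w x) * indicator E x) \<in> borel_measurable lebesgue"
      using weight_measurable_ennreal[OF w] E(1) by measurable
    fix u v assume uv: "u < v" "{u<..<v} \<subseteq> U"
    then have sub: "{u<..<v} \<subseteq> {a<..<b}" by (auto simp: U_def)
    then have au: "a \<le> u" "v \<le> b" using uv(1) by (auto simp: greaterThanLessThan_subseteq_greaterThanLessThan)
    have "wmass w (E \<inter> {u<..<v}) \<le> ennreal (l * (v - u))"
    proof (cases "E \<inter> {u<..<v} = {}")
      case False
      define S where "S = E \<inter> {u<..<v}"
      define s where "s = Sup S"
      have bd: "bdd_above S" by (intro bdd_aboveI[of _ v]) (auto simp: S_def)
      have Sne: "S \<noteq> {}" using False by (simp add: S_def)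
      have Ss: "x \<le> s" if "x \<in> S" for x using cSup_upper[OF that bd] by (simp add: s_def)
      have su: "s \<le> v" unfolding s_def using Sne by (intro cSup_least) (auto simp: S_def)
      have us: "u \<le> s" proof -
        obtain x where "x \<in> S" using Sne by blast
        then show ?thesis using Ss[of x] by (auto simp: S_def)
      qed
      have scl: "s \<in> closure S" using closure_contains_Sup[OF Sne bd] by (simp add: s_def)
      have clS: "closure S \<subseteq> {u..v}" by (rule closure_minimal) (auto simp: S_def)
      have "F s - l * s \<le> F u - l * u"
      proof (rule continuous_le_on_closure[of S "\<lambda>x. F x - l * x" s])
        show "continuous_on (closure S) (\<lambda>x. F x - l * x)"
          using clS au by (intro continuous_intros continuous_on_subset[OF F(1)]) auto
        show "F x - l * x \<le> F u - l * u" if "x \<in> S" for x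
        proof -
          have x: "x \<in> E" "u < x" "x < v" using that by (auto simp: S_def)
          have "wmass w {u..x} \<le> ennreal (l * (x - u))"
            using le[OF x(1)] x au unfolding left_max_le_iff[OF w l] by (meson atLeastLessThan_iff)
          then have "F x - F u \<le> l * (x - u)"
            using F(3)[of u x] x au l by (simp add: ennreal_le_iff)
          then show ?thesis by (simp add: algebra_simps)
        qed
      qed (rule scl)
      then have *: "F s - F u \<le> l * (v - u)" using su l mult_left_mono[of s v l] by (simp add: algebra_simps)
      have "wmass w (E \<inter> {u<..<v}) \<le> wmass w {u..s}"
        using Ss by (intro wmass_mono) (auto simp: S_def)
      also have "\<dots> \<le> ennreal (l * (v - u))" using F(3)[of u s] au us su * by (simp add: ennreal_leI)
      finally show ?thesis .
    qed simp
    moreover have "(\<integral>\<^sup>+x\<in>{u<..<v}. ennreal (w x) * indicator E x \<partial>lebesgue) = wmass w (E \<inter> {u<..<v})"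
      unfolding wmass_def by (intro nn_integral_cong) (auto simp: indicator_def)
    ultimately show "(\<integral>\<^sup>+x\<in>{u<..<v}. ennreal (w x) * indicator E x \<partial>lebesgue)
        \<le> ennreal l * (\<integral>\<^sup>+x\<in>{u<..<v}. 1 \<partial>lebesgue)"
      using uv(1) l by (simp add: ennreal_mult)
  qed simp
  moreover have "(\<integral>\<^sup>+x\<in>U. ennreal (w x) * indicator E x \<partial>lebesgue) = wmass w E"
    unfolding wmass_def using U(3) by (intro nn_integral_cong) (auto simp: indicator_def)
  ultimately have "wmass w E \<le> ennreal l * emeasure lebesgue U" using U by simp
  also have "emeasure lebesgue U \<le> emeasure lebesgue (E \<union> (V - E))"
    using V E(1) by (intro emeasure_mono) (auto simp: U_def)
  also have "\<dots> \<le> emeasure lebesgue E + emeasure lebesgue (V - E)"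
    using V E(1) by (intro emeasure_subadditive) auto
  also have "\<dots> \<le> emeasure lebesgue E + ennreal d" using V(3) by (intro add_left_mono) auto
  also have "ennreal l * (emeasure lebesgue E + ennreal d) = ennreal l * emeasure lebesgue E + ennreal (l * d)"
    using l d by (simp add: distrib_left ennreal_mult)
  also have "\<dots> \<le> ennreal l * emeasure lebesgue E + ennreal e"
    using d by (intro add_left_mono ennreal_leI)
  finally show "wmass w E \<le> ennreal l * emeasure lebesgue E + ennreal e"
    by (simp add: mult_left_mono)
qed

text \<open>
  If r separates left_max from w on a set B of finite measure, then the mass of B is at most r times
  its length, although w exceeds r throughout B; so B is null.
\<close>

lemma AE_weight_le_left_max:
  assumes w: "weight w"
  shows "AE x in lebesgue. x \<in> {a<..<b} \<longrightarrow> ennreal (w x) \<le> left_max w a x"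
proof -
  define B where "B r = {x \<in> {a<..<b}. left_max w a x \<le> ennreal r \<and> r < w x}" for r
  note wm = weight_borel_measurable[OF w]
  have nn: "0 \<le> w t" for t using w by (auto simp: weight_def)
  have null: "AE x in lebesgue. x \<notin> B r" if r: "0 \<le> r" for r
  proof -
    have "B r = ({a<..<b} - level_set w a b r) \<inter> {x \<in> space lebesgue. r < w x}"
      by (auto simp: B_def level_set_def)
    also have "\<dots> \<in> sets lebesgue"
    proof (rule sets.Int)
      show "{a<..<b} - level_set w a b r \<in> sets lebesgue"
        using open_level_set[OF w r, of a b] by (intro sets.Diff) auto
      show "{x \<in> space lebesgue. r < w x} \<in> sets lebesgue"
        by (rule borel_measurable_less[OF borel_measurable_const wm])
    qed
    finally have Bm: "B r \<in> sets lebesgue" .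
    have "emeasure lebesgue (B r) \<le> emeasure lebesgue {a..b}"
      by (intro emeasure_mono) (auto simp: B_def)
    also have "\<dots> < \<infinity>" by (simp add: emeasure_lborel_Icc_eq)
    finally have fin: "ennreal r * emeasure lebesgue (B r) \<noteq> \<infinity>" 
      by (auto simp: ennreal_mult_eq_top_iff)
    have meas: "(\<lambda>x. ennreal (w x - r) * indicator (B r) x) \<in> borel_measurable lebesgue"
      using wm Bm by measurable
    have "wmass w (B r) = (\<integral>\<^sup>+x. ennreal (w x - r) * indicator (B r) x + ennreal r * indicator (B r) x \<partial>lebesgue)"
      unfolding wmass_def
    proof (rule nn_integral_cong)
      fix x
      have "ennreal (w x) = ennreal (w x - r) + ennreal r" if "x \<in> B r"
        using that r by (subst ennreal_plus[symmetric]) (auto simp: B_def)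
      then show "ennreal (w x) * indicator (B r) x
          = ennreal (w x - r) * indicator (B r) x + ennreal r * indicator (B r) x"
        by (cases "x \<in> B r") auto
    qed
    also have "\<dots> = (\<integral>\<^sup>+x. ennreal (w x - r) * indicator (B r) x \<partial>lebesgue) + ennreal r * emeasure lebesgue (B r)"
      using meas Bm by (subst nn_integral_add) (auto simp: nn_integral_cmult_indicator)
    finally have split: "wmass w (B r) = (\<integral>\<^sup>+x. ennreal (w x - r) * indicator (B r) x \<partial>lebesgue)
        + ennreal r * emeasure lebesgue (B r)" .
    have "wmass w (B r) \<le> 0 + ennreal r * emeasure lebesgue (B r)"
      unfolding add_0 by (rule wmass_le_where_left_max_le[OF w r Bm, of a b]) (auto simp: B_def)
    then have "(\<integral>\<^sup>+x. ennreal (w x - r) * indicator (B r) x \<partial>lebesgue) = 0"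
      unfolding split using fin ennreal_add_left_cancel_le[of "ennreal r * emeasure lebesgue (B r)" _ 0]
      by (simp add: add.commute)
    then have "AE x in lebesgue. ennreal (w x - r) * indicator (B r) x = 0"
      using meas by (simp add: nn_integral_0_iff_AE)
    then show ?thesis
    proof eventually_elim
      case (elim x)
      then show ?case by (cases "x \<in> B r") (auto simp: B_def)
    qed
  qed
  have "AE x in lebesgue. \<forall>r\<in>{r\<in>\<rat>. 0 \<le> r}. x \<notin> B r"
  proof (subst AE_ball_countable)
    show "countable {r\<in>\<rat>. (0::real) \<le> r}" by (rule countable_subset[OF _ countable_rat]) auto
  qed (use null in auto)
  then show ?thesis
  proof eventually_elim
    fix x assume x: "\<forall>r\<in>{r\<in>\<rat>. 0 \<le> r}. x \<notin> B r"
    show "x \<in> {a<..<b} \<longrightarrow> ennreal (w x) \<le> left_max w a x"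
    proof (intro impI, rule ccontr)
      assume xI: "x \<in> {a<..<b}" and "\<not> ennreal (w x) \<le> left_max w a x"
      then have lt: "left_max w a x < ennreal (w x)" by simp
      then obtain m where m: "left_max w a x = ennreal m" "0 \<le> m" by (cases "left_max w a x") auto
      then have "m < w x" using lt by (simp add: ennreal_less_iff)
      then obtain r where "r \<in> \<rat>" "m < r" "r < w x" using Rats_dense_in_real by blast
      then show False using x xI m by (auto simp: B_def ennreal_leI)
    qed
  qed
qed

section \<open>Whitney decomposition of an interval towards its right endpoint\<close>

lemma set_nn_integral_cong_endpoints:
  fixes g :: "real \<Rightarrow> ennreal"
  assumes "E - {x, y} = F - {x, y}"
  shows "(\<integral>\<^sup>+t\<in>E. g t \<partial>lebesgue) = (\<integral>\<^sup>+t\<in>F. g t \<partial>lebesgue)"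
proof (rule nn_integral_cong_AE)
  have "AE t in lebesgue. t \<notin> {x, y}"
    by (intro AE_not_in null_sets_completionI) (auto intro: finite_imp_null_set_lborel)
  then show "AE t in lebesgue. g t * indicator E t = g t * indicator F t"
    by eventually_elim (use assms in \<open>auto simp: indicator_def\<close>)
qed

lemma set_nn_integral_split:
  fixes g :: "real \<Rightarrow> ennreal"
  assumes "g \<in> borel_measurable lebesgue" "x \<le> y" "y \<le> z"
  shows "(\<integral>\<^sup>+t\<in>{x..<z}. g t \<partial>lebesgue) = (\<integral>\<^sup>+t\<in>{x..<y}. g t \<partial>lebesgue) + (\<integral>\<^sup>+t\<in>{y..<z}. g t \<partial>lebesgue)"
proof -
  have "{x..<z} = {x..<y} \<union> {y..<z}" using assms by auto
  then have "emeasure (density lebesgue g) {x..<z}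
      = emeasure (density lebesgue g) {x..<y} + emeasure (density lebesgue g) {y..<z}"
    by (simp add: plus_emeasure)
  then show ?thesis using assms(1) by (simp add: emeasure_density)
qed

text \<open>
  Endpoints of the intervals of the Whitney decomposition of [a,b) towards b: the k-th interval is
  as long as its distance to b.
\<close>

definition whitney_point :: "real \<Rightarrow> real \<Rightarrow> nat \<Rightarrow> real" where
  "whitney_point a b k = b - (b - a) / 2 ^ k"

lemma whitney_point_0 [simp]: "whitney_point a b 0 = a"
  by (simp add: whitney_point_def)

lemma whitney_point_less: "a < b \<Longrightarrow> i < j \<Longrightarrow> whitney_point a b i < whitney_point a b j"
  unfolding whitney_point_def by (simp add: divide_strict_left_mono)

lemma whitney_point_le: "a < b \<Longrightarrow> i \<le> j \<Longrightarrow> whitney_point a b i \<le> whitney_point a b j"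
  using whitney_point_less[of a b i j] by (cases "i = j") auto

lemma whitney_point_bounds:
  assumes "a < b"
  shows "a \<le> whitney_point a b k" "whitney_point a b k < b"
  using whitney_point_le[OF assms, of 0 k] assms by (auto simp: whitney_point_def)

lemma Union_whitney_intervals:
  assumes ab: "a < b"
  shows "(\<Union>k. {a..<whitney_point a b k}) = {a..<b}"
proof (intro equalityI subsetI)
  fix x assume x: "x \<in> {a..<b}"
  obtain k where "(b - a) / (b - x) < 2 ^ k" using real_arch_pow[of 2 "(b - a) / (b - x)"] by auto
  then have "x < whitney_point a b k" using x by (simp add: whitney_point_def field_simps)
  then show "x \<in> (\<Union>k. {a..<whitney_point a b k})" using x by auto
qed (use whitney_point_bounds[OF ab] in \<open>auto intro: less_trans\<close>)

text \<open>
  One-sided estimates control the mass of an interval only by the mass of an interval reaching further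
  to the right. On Whitney intervals this loss is harmless, because the enlarged intervals overlap at
  most three times. The case k = 0 uses that k - 1 is then again 0, so that no enlarged
  interval leaves [a,b).
\<close>

lemma set_nn_integral_le_by_whitney:
  fixes g h :: "real \<Rightarrow> ennreal"
  assumes ab: "a < b"
    and g: "g \<in> borel_measurable lebesgue" and h: "h \<in> borel_measurable lebesgue"
    and le: "\<And>k. (\<integral>\<^sup>+x\<in>{whitney_point a b k..<whitney_point a b (Suc k)}. g x \<partial>lebesgue)
      \<le> C * (\<integral>\<^sup>+x\<in>{whitney_point a b (k - 1)..<whitney_point a b (k + 2)}. h x \<partial>lebesgue)"
  shows "(\<integral>\<^sup>+x\<in>{a..<b}. g x \<partial>lebesgue) \<le> 3 * C * (\<integral>\<^sup>+x\<in>{a..<b}. h x \<partial>lebesgue)"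
proof -
  define x where "x k = whitney_point a b k" for k
  define G where "G u v = (\<integral>\<^sup>+t\<in>{u..<v}. g t \<partial>lebesgue)" for u v
  define H where "H u v = (\<integral>\<^sup>+t\<in>{u..<v}. h t \<partial>lebesgue)" for u v
  have xm: "x i \<le> x j" if "i \<le> j" for i j
    using whitney_point_le[OF ab that] by (simp add: x_def)
  have ax: "a \<le> x k" and xb: "x k \<le> b" for k using whitney_point_bounds[OF ab, of k] by (auto simp: x_def)
  \<comment> \<open>The last three terms of the invariant absorb the overlaps: the newest enlarged interval glues to the oldest term.\<close>
  have inv: "G a (x n) \<le> C * (H a (x (n - 1)) + H a (x n) + H a (x (n + 1)))" for n
  proof (induction n)
    case 0 then show ?case by (simp add: G_def x_def)
  next
    case (Suc n)
    have "G a (x (Suc n)) = G a (x n) + G (x n) (x (Suc n))"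
      unfolding G_def by (intro set_nn_integral_split g ax xm) simp
    also have "\<dots> \<le> C * (H a (x (n - 1)) + H a (x n) + H a (x (n + 1))) + C * H (x (n - 1)) (x (n + 2))"
      using Suc.IH le[of n] by (intro add_mono) (auto simp: G_def H_def x_def)
    also have "\<dots> = C * (H a (x n) + H a (x (n + 1)) + (H a (x (n - 1)) + H (x (n - 1)) (x (n + 2))))"
      by (simp add: distrib_left ac_simps)
    also have "H a (x (n - 1)) + H (x (n - 1)) (x (n + 2)) = H a (x (n + 2))"
      unfolding H_def by (rule set_nn_integral_split[symmetric]) (auto intro: h ax xm)
    finally show ?case by simp
  qed
  have Hb: "H a (x k) \<le> H a b" for k
    unfolding H_def using xb[of k] by (intro nn_integral_mono) (auto simp: indicator_def)
  have bound: "G a (x n) \<le> 3 * C * H a b" for n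
  proof -
    have "G a (x n) \<le> C * (H a b + H a b + H a b)"
      by (rule order_trans[OF inv]) (intro mult_left_mono add_mono Hb; simp)
    also have "\<dots> = 3 * C * H a b"
    proof -
      have "(1 + 1 + 1 :: ennreal) = 3" by simp
      then have "H a b + H a b + H a b = 3 * H a b" by (metis distrib_right mult_1)
      then show ?thesis by (simp add: ac_simps)
    qed
    finally show ?thesis .
  qed
  have "G a b = emeasure (density lebesgue g) (\<Union>k. {a..<x k})"
    using g Union_whitney_intervals[OF ab] by (simp add: G_def emeasure_density x_def)
  also have "\<dots> = (SUP k. emeasure (density lebesgue g) {a..<x k})"
    using xm by (intro SUP_emeasure_incseq[symmetric]) (auto simp: incseq_def intro: less_le_trans)
  also have "\<dots> = (SUP k. G a (x k))" using g by (simp add: G_def emeasure_density)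
  also have "\<dots> \<le> 3 * C * H a b" using bound by (rule SUP_least)
  finally show ?thesis by (simp add: G_def H_def)
qed

section \<open>The one-sided constant and decay of level sets\<close>

lemma Ainf_integral_le:
  assumes w: "weight w" and ab: "a < b"
  shows "(\<integral>\<^sup>+x\<in>{a<..<b}. left_max w a x \<partial>lebesgue) \<le> Ainf_plus_const w * wmass w {a..b}"
proof -
  have eq: "(\<integral>\<^sup>+x\<in>{a<..<b}. M_minus (\<lambda>t. w t * indicator {a<..<b} t) x \<partial>lebesgue)
      = (\<integral>\<^sup>+x\<in>{a<..<b}. left_max w a x \<partial>lebesgue)" (is "?I = ?J")
    by (intro nn_integral_cong) (auto simp: M_minus_restrict_eq_left_max[OF w] split: split_indicator)
  show ?thesis
  proof (cases "wmass w {a..b} = 0")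
    case True
    have "?J = (\<integral>\<^sup>+(x::real). 0 \<partial>lebesgue)"
      by (intro nn_integral_cong) (auto simp: indicator_def left_max_zero_mass[OF True])
    then show ?thesis by simp
  next
    case False
    have "?J / wmass w {a..b} \<le> Ainf_plus_const w"
      unfolding Ainf_plus_const_def eq[symmetric] wmass_interval_eq(1)[of w a b, symmetric]
      using ab by (intro SUP_upper2[of "(a, b)"]) (auto simp: wmass_interval_eq)
    then have "?J / wmass w {a..b} * wmass w {a..b} \<le> Ainf_plus_const w * wmass w {a..b}"
      by (rule mult_right_mono) simp
    then show ?thesis using False wmass_Icc_finite[OF w, of a b]
      by (simp add: ennreal_divide_times ennreal_mult_divide_eq ennreal_times_divide)
  qed
qed

lemma Ainf_plus_const_leI:
  assumes w: "weight w"
    and le: "\<And>a b. a < b \<Longrightarrow> (\<integral>\<^sup>+x\<in>{a<..<b}. left_max w a x \<partial>lebesgue) \<le> C * wmass w {a..b}"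
  shows "Ainf_plus_const w \<le> C"
  unfolding Ainf_plus_const_def
proof (rule SUP_least, clarify)
  fix a b :: real assume ab: "a < b"
  have eq: "(\<integral>\<^sup>+x\<in>{a<..<b}. M_minus (\<lambda>t. w t * indicator {a<..<b} t) x \<partial>lebesgue)
      = (\<integral>\<^sup>+x\<in>{a<..<b}. left_max w a x \<partial>lebesgue)" (is "?I = ?J")
    by (intro nn_integral_cong) (auto simp: M_minus_restrict_eq_left_max[OF w] split: split_indicator)
  show "?I / wmass w {a<..<b} \<le> C"
  proof (cases "wmass w {a..b} = 0")
    case True
    then show ?thesis using le[OF ab] by (simp add: eq wmass_interval_eq)
  next
    case False
    have "?J / wmass w {a..b} \<le> C * wmass w {a..b} / wmass w {a..b}"
      by (rule divide_right_mono_ennreal[OF le[OF ab]])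
    also have "\<dots> = C" using False wmass_Icc_finite[OF w, of a b] by (simp add: ennreal_mult_divide_eq)
    finally show ?thesis by (simp add: eq wmass_interval_eq)
  qed
qed

text \<open>
  The maximal function dominates w almost everywhere. Some lower bound for the constant is indispensable for an estimate with a multiple of the constant
  in the exponent: the number of dyadic levels used below is only bounded by a multiple of A + 1.
\<close>

lemma Ainf_plus_const_ge_1:
  assumes w: "weight w" and nz: "\<not> (AE x in lebesgue. w x = 0)"
  shows "1 \<le> Ainf_plus_const w"
proof -
  have nn: "0 \<le> w t" for t using w by (auto simp: weight_def)
  \<comment> \<open>A fixed interval of positive and finite mass, on which the trivial lower bound w can be tested.\<close>
  have "\<exists>n::nat. wmass w {- real n..real n} \<noteq> 0"
  proof (rule ccontr)
    assume "\<not> ?thesis"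
    then have "AE x in lebesgue. ennreal (w x) * indicator {- real n..real n} x = 0" for n :: nat
      unfolding wmass_def using weight_measurable_ennreal[OF w]
      by (subst nn_integral_0_iff_AE[symmetric]) (auto intro!: borel_measurable_times_ennreal borel_measurable_indicator)
    then have "AE x in lebesgue. \<forall>n::nat. ennreal (w x) * indicator {- real n..real n} x = 0"
      unfolding AE_all_countable by blast
    then have "AE x in lebesgue. w x = 0"
    proof eventually_elim
      case (elim x)
      obtain n :: nat where "\<bar>x\<bar> \<le> real n" using real_arch_simple by blast
      then have "x \<in> {- real n..real n}" by auto
      then show ?case using elim[rule_format, of n] nn[of x] by (auto simp: ennreal_eq_0_iff)
    qed
    then show False using nz by simp
  qed
  then obtain n :: nat where n: "wmass w {- real n..real n} \<noteq> 0" by blast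
  have n0: "n \<noteq> 0"
  proof
    assume "n = 0"
    then have "wmass w {- real n..real n} = wmass w {}"
      by (intro wmass_cong_endpoints[of _ 0 0]) auto
    then show False using n by simp
  qed
  let ?I = "{- real n<..<real n}"
  have "wmass w ?I \<le> (\<integral>\<^sup>+x\<in>?I. left_max w (- real n) x \<partial>lebesgue)"
    unfolding wmass_def
  proof (rule nn_integral_mono_AE)
    show "AE x in lebesgue. ennreal (w x) * indicator ?I x \<le> left_max w (- real n) x * indicator ?I x"
      using AE_weight_le_left_max[OF w, of "- real n" "real n"]
      by eventually_elim (auto simp: indicator_def)
  qed
  also have "\<dots> \<le> Ainf_plus_const w * wmass w {- real n..real n}"
    using n0 by (intro Ainf_integral_le w) auto
  finally have "wmass w {- real n..real n} \<le> Ainf_plus_const w * wmass w {- real n..real n}"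
    by (simp add: wmass_interval_eq)
  then have "wmass w {- real n..real n} / wmass w {- real n..real n} \<le>
      Ainf_plus_const w * wmass w {- real n..real n} / wmass w {- real n..real n}"
    by (rule divide_right_mono_ennreal)
  then show ?thesis using n wmass_Icc_finite[OF w, of "- real n" "real n"]
    by (simp add: ennreal_mult_divide_eq)
qed

lemma sum_power2_le: "(\<Sum>k\<le>n. 2 ^ k :: real) \<le> 2 ^ Suc n - 1"
  by (induction n) auto

lemma dyadic_sum_le:
  fixes N :: ennreal
  assumes l: "0 \<le> l"
  shows "(\<Sum>k\<le>n. if ennreal (2 ^ k * l) < N then ennreal (2 ^ k * l) else 0) \<le> 2 * N"
proof (induction n)
  case 0
  show ?case
  proof (cases "ennreal l < N")
    case True
    then have "ennreal l + 0 \<le> N + N" by (intro add_mono) auto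
    then show ?thesis using True by (simp add: mult_2)
  qed simp
next
  case (Suc n)
  show ?case
  proof (cases "ennreal (2 ^ Suc n * l) < N")
    case True
    have "(\<Sum>k\<le>Suc n. if ennreal (2 ^ k * l) < N then ennreal (2 ^ k * l) else 0)
        \<le> (\<Sum>k\<le>Suc n. ennreal (2 ^ k * l))"
      by (intro sum_mono) auto
    also have "\<dots> = ennreal (\<Sum>k\<le>Suc n. 2 ^ k * l)" using l by (intro sum_ennreal) auto
    also have "(\<Sum>k\<le>Suc n. 2 ^ k * l) = (\<Sum>k\<le>Suc n. 2 ^ k) * l" by (simp only: sum_distrib_right)
    also have "ennreal ((\<Sum>k\<le>Suc n. 2 ^ k) * l) \<le> ennreal (2 * (2 ^ Suc n * l))"
      using l sum_power2_le[of "Suc n"] mult_right_mono[of "\<Sum>k\<le>Suc n. 2 ^ k" "2 * 2 ^ Suc n" l]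
      by (intro ennreal_leI) (simp add: mult.assoc)
    also have "\<dots> = 2 * ennreal (2 ^ Suc n * l)" by (subst ennreal_mult) (use l in auto)
    also have "\<dots> \<le> 2 * N" using True by (intro mult_left_mono) auto
    finally show ?thesis .
  next
    case False
    then show ?thesis using Suc.IH by simp
  qed
qed

text \<open>
  On each component (p,q) the local maximal function of (a,t) coincides with that of (p,q), so the
  defining inequality of the constant applies to every component separately.
\<close>

lemma level_set_integral_le:
  assumes w: "weight w" and l: "0 \<le> l" and at: "a < t" and t: "left_max w a t \<le> ennreal l"
  shows "(\<integral>\<^sup>+x\<in>level_set w a t l. left_max w a x \<partial>lebesgue)
    \<le> Ainf_plus_const w * wmass w (level_set w a t l)"
proof -
  let ?O = "level_set w a t l"
  let ?g = "\<lambda>x. left_max w a x * indicator {a<..<t} x"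
  have restr: "(\<integral>\<^sup>+x\<in>S. ?g x \<partial>lebesgue) = (\<integral>\<^sup>+x\<in>S. left_max w a x \<partial>lebesgue)" if "S \<subseteq> {a<..<t}" for S
    using that by (intro nn_integral_cong) (auto simp: indicator_def)
  have "(\<integral>\<^sup>+x\<in>?O. ?g x \<partial>lebesgue) \<le> Ainf_plus_const w * (\<integral>\<^sup>+x\<in>?O. ennreal (w x) \<partial>lebesgue)"
  proof (rule set_nn_integral_le_by_components[OF open_level_set[OF w l] bounded_level_set
        left_max_measurable[OF w] weight_measurable_ennreal[OF w]])
    fix p q assume pq: "p < q" "{p<..<q} \<subseteq> ?O" "p \<notin> ?O" "q \<notin> ?O"
    have "(\<integral>\<^sup>+x\<in>{p<..<q}. ?g x \<partial>lebesgue) = (\<integral>\<^sup>+x\<in>{p<..<q}. left_max w a x \<partial>lebesgue)"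
      using pq(2) level_set_subset by (intro restr) blast
    also have "\<dots> = (\<integral>\<^sup>+x\<in>{p<..<q}. left_max w p x \<partial>lebesgue)"
      using level_set_component(3)[OF w l at t pq] by (intro nn_integral_cong) (auto simp: indicator_def)
    also have "\<dots> \<le> Ainf_plus_const w * wmass w {p<..<q}"
      unfolding wmass_interval_eq by (rule Ainf_integral_le[OF w pq(1)])
    finally show "(\<integral>\<^sup>+x\<in>{p<..<q}. ?g x \<partial>lebesgue)
        \<le> Ainf_plus_const w * (\<integral>\<^sup>+x\<in>{p<..<q}. ennreal (w x) \<partial>lebesgue)"
      by (simp add: wmass_def)
  qed
  then show ?thesis by (simp add: restr level_set_subset wmass_def)
qed

text \<open>
  Layer cake. The level sets O_k at the levels 2^k l have masses W_k = 2^k l |O_k|, so up to a factor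
  2 the sum of W_0, ..., W_n is at most the integral of the maximal function over O_0, that is,
  at most A W_0. The W_k decrease, so the last of n + 1 terms is at most 2 A W_0 / (n + 1).
\<close>

lemma level_set_halving:
  assumes w: "weight w" and A: "Ainf_plus_const w = ennreal A" "0 < A" and n: "4 * A \<le> real n + 1"
    and l: "0 \<le> l" and at: "a < t" and t: "left_max w a t \<le> ennreal l"
  shows "2 * wmass w (level_set w a t (2 ^ n * l)) \<le> wmass w (level_set w a t l)"
proof -
  let ?O = "\<lambda>k. level_set w a t (2 ^ k * l)"
  let ?W = "\<lambda>k. wmass w (?O k)"
  have lk: "0 \<le> 2 ^ k * l" "l \<le> 2 ^ k * l" for k :: nat
    using l mult_right_mono[of 1 "2 ^ k" l] by auto
  have W: "?W k = ennreal (2 ^ k * l) * emeasure lebesgue (?O k)" for k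
    using lk by (intro wmass_level_set w at order_trans[OF t] ennreal_leI) auto
  have "of_nat (n + 1) * ?W n = (\<Sum>k\<le>n. ?W n)" by simp
  also have "\<dots> \<le> (\<Sum>k\<le>n. ?W k)"
  proof (rule sum_mono)
    fix k assume "k \<in> {..n}"
    then have "2 ^ k * l \<le> 2 ^ n * l" using l by (intro mult_right_mono power_increasing) auto
    then show "?W n \<le> ?W k" by (intro wmass_mono level_set_antimono)
  qed
  also have "\<dots> = (\<Sum>k\<le>n. \<integral>\<^sup>+x. ennreal (2 ^ k * l) * indicator (?O k) x \<partial>lebesgue)"
    using open_level_set[OF w lk(1)] by (simp add: W nn_integral_cmult_indicator)
  also have "\<dots> = (\<integral>\<^sup>+x. (\<Sum>k\<le>n. ennreal (2 ^ k * l) * indicator (?O k) x) \<partial>lebesgue)"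
    using open_level_set[OF w lk(1)]
    by (intro nn_integral_sum[symmetric] borel_measurable_times_ennreal borel_measurable_indicator) auto
  also have "\<dots> \<le> (\<integral>\<^sup>+x. 2 * (left_max w a x * indicator {a<..<t} x * indicator (level_set w a t l) x) \<partial>lebesgue)"
  proof (rule nn_integral_mono)
    fix x :: real
    show "(\<Sum>k\<le>n. ennreal (2 ^ k * l) * indicator (?O k) x)
        \<le> 2 * (left_max w a x * indicator {a<..<t} x * indicator (level_set w a t l) x)"
    proof (cases "x \<in> level_set w a t l")
      case True
      then have "x \<in> {a<..<t}" using level_set_subset by blast
      moreover have "(\<Sum>k\<le>n. ennreal (2 ^ k * l) * indicator (?O k) x)
          = (\<Sum>k\<le>n. if ennreal (2 ^ k * l) < left_max w a x then ennreal (2 ^ k * l) else 0)"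
        using \<open>x \<in> {a<..<t}\<close> by (intro sum.cong) (auto simp: level_set_def)
      ultimately show ?thesis using True dyadic_sum_le[OF l, where n=n and N="left_max w a x"] by simp
    next
      case False
      then have "x \<notin> ?O k" for k using level_set_antimono[OF lk(2)] by blast
      then show ?thesis by simp
    qed
  qed
  also have "\<dots> = 2 * (\<integral>\<^sup>+x. left_max w a x * indicator {a<..<t} x * indicator (level_set w a t l) x \<partial>lebesgue)"
    using left_max_measurable[OF w, of a t] open_level_set[OF w l]
    by (intro nn_integral_cmult borel_measurable_times_ennreal[OF left_max_measurable[OF w]]
        borel_measurable_indicator) auto
  also have "\<dots> = 2 * (\<integral>\<^sup>+x\<in>level_set w a t l. left_max w a x \<partial>lebesgue)"
    using level_set_subset[of w a t l]
    by (intro arg_cong[where f="\<lambda>x. 2 * x"] nn_integral_cong) (auto simp: indicator_def)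
  also have "\<dots> \<le> 2 * (ennreal A * wmass w (level_set w a t l))"
    using level_set_integral_le[OF w l at t] by (intro mult_left_mono) (auto simp: A)
  finally have main: "of_nat (n + 1) * ?W n \<le> 2 * (ennreal A * wmass w (level_set w a t l))" .
  have fin: "wmass w (level_set w a t k) < \<infinity>" for k
  proof -
    have "level_set w a t k \<subseteq> {a..t}" using level_set_subset[of w a t k] by force
    then show ?thesis using wmass_Icc_finite[OF w] wmass_mono le_less_trans by blast
  qed
  obtain u where u: "?W n = ennreal u" "0 \<le> u" using fin[of "2 ^ n * l"] by (cases "?W n") auto
  obtain v where v: "wmass w (level_set w a t l) = ennreal v" "0 \<le> v"
    using fin[of l] by (cases "wmass w (level_set w a t l)") auto
  have "(real n + 1) * u \<le> 2 * (A * v)"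
  proof -
    have "ennreal ((real n + 1) * u) \<le> ennreal (2 * (A * v))"
      using main A u v by (simp add: ennreal_mult ennreal_of_nat_eq_real_of_nat add.commute flip: ennreal_plus)
    then show ?thesis using A v by simp
  qed
  moreover have "4 * A * u \<le> (real n + 1) * u" using n u by (intro mult_right_mono) auto
  ultimately have "A * (2 * u) \<le> A * v" by simp
  then have "2 * u \<le> v" using A by simp
  then have "ennreal (2 * u) \<le> ennreal v" by (rule ennreal_leI)
  then show ?thesis using u v by (simp add: ennreal_mult)
qed

lemma level_set_decay:
  assumes w: "weight w" and A: "Ainf_plus_const w = ennreal A" "0 < A" and n: "4 * A \<le> real n + 1"
    and l: "0 \<le> l" and at: "a < t" and t: "left_max w a t \<le> ennreal l"
  shows "2 ^ j * wmass w (level_set w a t (2 ^ (n * j) * l)) \<le> wmass w (level_set w a t l)"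
proof (induction j)
  case (Suc j)
  have l': "0 \<le> 2 ^ (n * j) * l" "l \<le> 2 ^ (n * j) * l"
    using l mult_right_mono[of 1 "2 ^ (n * j)" l] by auto
  have "2 * wmass w (level_set w a t (2 ^ n * (2 ^ (n * j) * l))) \<le> wmass w (level_set w a t (2 ^ (n * j) * l))"
    by (intro level_set_halving[OF w A n] l' at order_trans[OF t] ennreal_leI)
  then have "2 ^ j * (2 * wmass w (level_set w a t (2 ^ n * (2 ^ (n * j) * l))))
      \<le> 2 ^ j * wmass w (level_set w a t (2 ^ (n * j) * l))"
    by (rule mult_left_mono) simp
  then show ?case using Suc.IH by (simp add: power_add ac_simps)
qed simp

text \<open>
  The mass of a set of small measure. Split E along the level set at height 2^(n j) l, where
  l = w(a,c)/(c - b). Off the level set w is bounded by that height, which costs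
  2^(n j) \<eta>; the level set itself has lost j factors 2 of its mass.
\<close>

lemma wmass_small_set_le:
  assumes w: "weight w" and A: "Ainf_plus_const w = ennreal A" "0 < A" and n: "4 * A \<le> real n + 1"
    and abc: "a < b" "b < c" and E: "E \<in> sets lebesgue" "E \<subseteq> {a<..<b}"
    and \<eta>: "0 \<le> \<eta>" "emeasure lebesgue E \<le> ennreal (\<eta> * (c - b))"
  shows "wmass w E \<le> ennreal (2 ^ (n * j) * \<eta> + (1 / 2) ^ j) * wmass w {a..c}"
proof -
  obtain m where m: "wmass w {a..c} = ennreal m" "0 \<le> m"
    using wmass_Icc_finite[OF w, of a c] by (cases "wmass w {a..c}") auto
  define l where "l = m / (c - b)"
  have l: "0 \<le> l" "l * (c - b) = m" using m abc by (auto simp: l_def)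
  obtain t where t: "b \<le> t" "t \<le> c" "left_max w a t \<le> ennreal l"
    using exists_left_max_le[OF w abc l(1)] l m by auto
  have at: "a < t" using t abc by auto
  define L where "L = 2 ^ (n * j) * l"
  have L: "0 \<le> L" using l by (simp add: L_def)
  define U where "U = level_set w a t L"
  have U: "open U" "U \<subseteq> {a..c}"
    using open_level_set[OF w L] level_set_subset[of w a t L] t by (auto simp: U_def)
  have "wmass w (E - U) \<le> ennreal L * emeasure lebesgue (E - U)"
    using E U t by (intro wmass_le_where_left_max_le[OF w L, of _ a b])
      (auto simp: U_def level_set_def not_less)
  also have "\<dots> \<le> ennreal L * ennreal (\<eta> * (c - b))"
    using E U by (intro mult_left_mono order_trans[OF emeasure_mono \<eta>(2)]) auto
  also have "\<dots> = ennreal (2 ^ (n * j) * \<eta> * m)"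
    using L \<eta> abc l(2) by (simp add: L_def ennreal_mult[symmetric] ac_simps flip: l(2))
  finally have 1: "wmass w (E - U) \<le> ennreal (2 ^ (n * j) * \<eta> * m)" .
  have "wmass w U < \<infinity>" using le_less_trans[OF wmass_mono[OF U(2)] wmass_Icc_finite[OF w]] .
  then obtain v where v: "wmass w U = ennreal v" "0 \<le> v" by (cases "wmass w U") auto
  have "level_set w a t l \<subseteq> {a..c}" using level_set_subset[of w a t l] t by fastforce
  then have "2 ^ j * wmass w U \<le> ennreal m"
    using level_set_decay[OF w A n l(1) at t(3), of j] wmass_mono[of _ "{a..c}" w] m
    unfolding U_def L_def by (metis order_trans)
  moreover have "2 ^ j * wmass w U = ennreal (2 ^ j * v)"
    using v by (simp add: ennreal_mult flip: ennreal_numeral ennreal_power)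
  ultimately have "2 ^ j * v \<le> m" using m by simp
  then have "v \<le> (1 / 2) ^ j * m" by (simp add: field_simps)
  then have 2: "wmass w U \<le> ennreal ((1 / 2) ^ j * m)" using v by (simp add: ennreal_leI)
  have "wmass w E \<le> wmass w ((E - U) \<union> U)" by (rule wmass_mono) auto
  also have "\<dots> \<le> wmass w (E - U) + wmass w U" using E U by (intro wmass_subadditive w) auto
  also have "\<dots> \<le> ennreal (2 ^ (n * j) * \<eta> * m) + ennreal ((1 / 2) ^ j * m)" by (intro add_mono 1 2)
  also have "\<dots> = ennreal (2 ^ (n * j) * \<eta> + (1 / 2) ^ j) * wmass w {a..c}"
    using m \<eta> by (simp add: distrib_right ennreal_mult[symmetric] flip: ennreal_plus)
  finally show ?thesis .
qed

text \<open>
  With 2^(n j) close to e^(-1/2) the first term is about e^(1/2) and the second about e^(1/(2 n)),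
  which is the larger of the two.
\<close>

lemma exists_dyadic_balance:
  fixes e :: real
  assumes e: "0 < e" "e \<le> 1" and n: "1 \<le> n"
  shows "\<exists>j. 2 ^ (n * j) * (4 * e) + (1 / 2) ^ j \<le> 6 * e powr (1 / (2 * real n))"
proof -
  \<comment> \<open>The exact solution of 2^(n x) = e^(-1/2).\<close>
  define x where "x = - ln e / (2 * real n * ln 2)"
  have x0: "0 \<le> x" using e n by (simp add: x_def divide_nonpos_pos)
  define j where "j = nat \<lfloor>x\<rfloor>"
  have j: "real j \<le> x" "x \<le> real j + 1" using x0 unfolding j_def by linarith+
  have "2 ^ (n * j) = 2 powr (real n * real j)" by (simp add: powr_realpow flip: of_nat_mult)
  also have "\<dots> \<le> 2 powr (real n * x)" using j by (intro powr_mono mult_left_mono) auto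
  also have "\<dots> = e powr (- 1 / 2)"
    using e n by (simp add: powr_def x_def field_simps)
  finally have "2 ^ (n * j) * (4 * e) \<le> e powr (- 1 / 2) * (4 * e)"
    using e by (intro mult_right_mono) auto
  also have "\<dots> = 4 * e powr (1 / 2)"
    using e powr_add[of e "- 1 / 2" 1] by simp
  also have "e powr (1 / 2) \<le> e powr (1 / (2 * real n))"
    using e n by (intro powr_mono') (auto simp: field_simps)
  finally have 1: "2 ^ (n * j) * (4 * e) \<le> 4 * e powr (1 / (2 * real n))" by simp
  have "(1 / 2 :: real) ^ j = 2 powr (- real j)"
    by (simp add: powr_minus powr_realpow power_one_over inverse_eq_divide)
  also have "\<dots> \<le> 2 powr (1 - x)" using j by (intro powr_mono) auto
  also have "\<dots> = 2 * 2 powr (- x)" by (simp add: powr_diff powr_minus field_simps)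
  also have "2 powr (- x) = e powr (1 / (2 * real n))"
    using e n by (simp add: powr_def x_def field_simps)
  finally have "(1 / 2) ^ j \<le> 2 * e powr (1 / (2 * real n))" .
  then show ?thesis using 1 by (intro exI[of _ j]) linarith
qed

section \<open>Superlevel sets of the forward maximal function of an indicator\<close>

lemma wmass_indicator:
  "E \<in> sets lebesgue \<Longrightarrow> S \<in> sets lebesgue \<Longrightarrow> wmass (indicator E) S = emeasure lebesgue (E \<inter> S)"
proof -
  assume "E \<in> sets lebesgue" "S \<in> sets lebesgue"
  moreover have "wmass (indicator E) S = (\<integral>\<^sup>+x. indicator (E \<inter> S) x \<partial>lebesgue)"
    unfolding wmass_def by (intro nn_integral_cong) (auto simp: indicator_def)
  ultimately show ?thesis by simp
qed

lemma weight_indicator: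
  assumes "E \<in> sets lebesgue"
  shows "weight (indicator E)"
  unfolding weight_def locally_integrable_def
proof (intro conjI allI impI)
  fix K :: "real set" assume K: "compact K"
  have "emeasure lebesgue (K \<inter> E) \<le> emeasure lebesgue K"
    using K assms by (intro emeasure_mono) (auto simp: borel_compact)
  also have "\<dots> < \<infinity>" using K emeasure_compact_finite[OF K] by (simp add: borel_compact)
  finally have "integrable lebesgue (indicator (K \<inter> E) :: real \<Rightarrow> real)"
    using K assms by (intro integrable_real_indicator) (auto simp: borel_compact)
  moreover have "(\<lambda>x. indicator K x *\<^sub>R indicator E x :: real) = indicator (K \<inter> E)"
    by (auto simp: indicator_def)
  ultimately show "(indicator E :: real \<Rightarrow> real) absolutely_integrable_on K"
    by (simp add: set_integrable_def)
qed simp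

lemma less_M_plus_indicator_iff:
  assumes E: "E \<in> sets lebesgue" and \<alpha>: "0 \<le> \<alpha>"
  shows "ennreal \<alpha> < M_plus (indicator E) x \<longleftrightarrow>
    (\<exists>y>x. ennreal (\<alpha> * (y - x)) < wmass (indicator E) {x..y})"
proof -
  have eq: "ennreal \<alpha> < ennreal (1 / h) * (\<integral>\<^sup>+t\<in>{x..x + h}. ennreal \<bar>indicator E t\<bar> \<partial>lebesgue)
      \<longleftrightarrow> ennreal (\<alpha> * h) < wmass (indicator E) {x..x + h}" if h: "0 < h" for h
  proof -
    have I: "(\<integral>\<^sup>+t\<in>{x..x + h}. ennreal \<bar>indicator E t\<bar> \<partial>lebesgue) = wmass (indicator E) {x..x + h}"
      unfolding wmass_def by (intro nn_integral_cong) (auto simp: indicator_def)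
    obtain m where m: "wmass (indicator E) {x..x + h} = ennreal m" "0 \<le> m"
      using wmass_Icc_finite[OF weight_indicator[OF E], of x "x + h"]
      by (cases "wmass (indicator E) {x..x + h}") auto
    have "ennreal (1 / h) * ennreal m = ennreal (m / h)"
      using h m by (subst ennreal_mult[symmetric]) auto
    then show ?thesis unfolding I m(1) using h m(2) \<alpha>
      by (simp add: ennreal_less_iff pos_less_divide_eq)
  qed
  show ?thesis
  proof
    assume "ennreal \<alpha> < M_plus (indicator E) x"
    then obtain h where "0 < h"
      "ennreal \<alpha> < ennreal (1 / h) * (\<integral>\<^sup>+t\<in>{x..x + h}. ennreal \<bar>indicator E t\<bar> \<partial>lebesgue)"
      unfolding M_plus_def less_SUP_iff by auto
    then show "\<exists>y>x. ennreal (\<alpha> * (y - x)) < wmass (indicator E) {x..y}"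
      using eq by (intro exI[of _ "x + h"]) auto
  next
    assume "\<exists>y>x. ennreal (\<alpha> * (y - x)) < wmass (indicator E) {x..y}"
    then obtain y where "x < y" "ennreal (\<alpha> * (y - x)) < wmass (indicator E) {x..y}" by blast
    then show "ennreal \<alpha> < M_plus (indicator E) x"
      unfolding M_plus_def less_SUP_iff using eq[of "y - x"] by (intro bexI[of _ "y - x"]) auto
  qed
qed

definition tauberian_set :: "real set \<Rightarrow> real \<Rightarrow> real set" where
  "tauberian_set E \<alpha> = {x. M_plus (indicator E) x > ennreal \<alpha>}"

lemma tauberian_set_iff:
  assumes "E \<in> sets lebesgue" "0 \<le> \<alpha>"
  shows "x \<in> tauberian_set E \<alpha> \<longleftrightarrow> (\<exists>y>x. ennreal (\<alpha> * (y - x)) < wmass (indicator E) {x..y})"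
  using less_M_plus_indicator_iff[OF assms] by (simp add: tauberian_set_def)

lemma open_tauberian_set:
  assumes E: "E \<in> sets lebesgue" and \<alpha>: "0 \<le> \<alpha>"
  shows "open (tauberian_set E \<alpha>)"
proof (rule openI)
  fix x assume "x \<in> tauberian_set E \<alpha>"
  then obtain y where y: "x < y" "ennreal (\<alpha> * (y - x)) < wmass (indicator E) {x..y}"
    unfolding tauberian_set_iff[OF assms] by blast
  obtain F where F: "continuous_on {x - 1..y} F"
    "\<And>u v. x - 1 \<le> u \<Longrightarrow> u \<le> v \<Longrightarrow> v \<le> y \<Longrightarrow> F u \<le> F v"
    "\<And>u v. x - 1 \<le> u \<Longrightarrow> u \<le> v \<Longrightarrow> v \<le> y \<Longrightarrow> wmass (indicator E) {u..v} = ennreal (F v - F u)"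
    using wmass_primitive[OF weight_indicator[OF E], of "x - 1" y] by blast
  let ?V = "(\<lambda>z. F y - F z - \<alpha> * (y - z)) -` {0<..} \<inter> {x - 1<..<y}"
  have "open ?V"
    by (intro continuous_on_open_vimage[THEN iffD1, rule_format])
       (auto intro!: continuous_intros intro: continuous_on_subset[OF F(1)])
  moreover have "x \<in> ?V" using y \<alpha> by (simp add: F(3) ennreal_less_iff)
  moreover have "?V \<subseteq> tauberian_set E \<alpha>"
  proof
    fix z assume z: "z \<in> ?V"
    then have "ennreal (\<alpha> * (y - z)) < wmass (indicator E) {z..y}"
      using \<alpha> by (simp add: F(3) ennreal_less_iff)
    then show "z \<in> tauberian_set E \<alpha>" unfolding tauberian_set_iff[OF assms] using z by auto
  qed
  ultimately show "\<exists>e>0. ball x e \<subseteq> tauberian_set E \<alpha>" by (meson openE order_trans)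
qed

lemma tauberian_set_witness_bound:
  assumes E: "E \<in> sets lebesgue" "E \<subseteq> {- R..R}" and \<alpha>: "1 / 2 \<le> \<alpha>"
    and y: "x < y" "ennreal (\<alpha> * (y - x)) < wmass (indicator E) {x..y}"
  shows "x \<in> {- 5 * R..R}" "y \<in> {- R..5 * R}"
proof -
  have m: "wmass (indicator E) {x..y} = emeasure lebesgue (E \<inter> {x..y})"
    using E by (intro wmass_indicator) auto
  have "E \<inter> {x..y} \<noteq> {}"
  proof
    assume "E \<inter> {x..y} = {}"
    then show False using y m by simp
  qed
  then obtain z where "z \<in> E" "x \<le> z" "z \<le> y" by auto
  then have z: "x \<le> R" "- R \<le> y" "0 \<le> R" using E by auto
  have "emeasure lebesgue (E \<inter> {x..y}) \<le> emeasure lebesgue {- R..R}"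
    using E by (intro emeasure_mono) auto
  also have "\<dots> = ennreal (2 * R)" using z by simp
  finally have "ennreal (\<alpha> * (y - x)) < ennreal (2 * R)" using y m by simp
  then have "\<alpha> * (y - x) < 2 * R" using y \<alpha> by (simp add: ennreal_less_iff)
  moreover have "1 / 2 * (y - x) \<le> \<alpha> * (y - x)" using \<alpha> y by (intro mult_right_mono) auto
  ultimately have "y - x < 4 * R" by simp
  then show "x \<in> {- 5 * R..R}" "y \<in> {- R..5 * R}" using z by auto
qed

lemma tauberian_set_subset:
  assumes "E \<in> sets lebesgue" "E \<subseteq> {- R..R}" "1 / 2 \<le> \<alpha>"
  shows "tauberian_set E \<alpha> \<subseteq> {- 5 * R..R}"
proof
  fix x assume "x \<in> tauberian_set E \<alpha>"
  then obtain y where "x < y" "ennreal (\<alpha> * (y - x)) < wmass (indicator E) {x..y}"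
    using assms by (auto simp: tauberian_set_iff)
  then show "x \<in> {- 5 * R..R}" using tauberian_set_witness_bound[OF assms] by blast
qed

text \<open>
  The mirror image of the rising sun lemma: on a component (p,q), every interval (x,q) is filled
  by E up to a proportion 1 - \<alpha>. So the complement of E is thin at every scale seen from q.
\<close>

lemma tauberian_set_component:
  assumes E: "E \<in> sets lebesgue" "E \<subseteq> {- R..R}" and \<alpha>: "1 / 2 \<le> \<alpha>" "\<alpha> < 1"
    and pq: "p < q" "{p<..<q} \<subseteq> tauberian_set E \<alpha>" "q \<notin> tauberian_set E \<alpha>"
    and x: "p \<le> x" "x \<le> q"
  shows "emeasure lebesgue ({x..q} - E) \<le> ennreal ((1 - \<alpha>) * (q - x))"
proof -
  let ?e = "indicator E :: real \<Rightarrow> real"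
  have a0: "0 \<le> \<alpha>" using \<alpha> by simp
  have we: "weight ?e" by (rule weight_indicator[OF E(1)])
  note iff = tauberian_set_iff[OF E(1) a0]
  have sub: "{p<..<q} \<subseteq> {- 5 * R..R}" using pq(2) tauberian_set_subset[OF E \<alpha>(1)] by blast
  then have pR: "- 5 * R \<le> p" "q \<le> R" using pq(1)
    by (auto simp: greaterThanLessThan_subseteq_atLeastAtMost_iff)
  then have R: "0 \<le> R" using pq(1) by auto
  obtain F where F: "continuous_on {- 5 * R..5 * R} F"
    "\<And>u v. - 5 * R \<le> u \<Longrightarrow> u \<le> v \<Longrightarrow> v \<le> 5 * R \<Longrightarrow> F u \<le> F v"
    "\<And>u v. - 5 * R \<le> u \<Longrightarrow> u \<le> v \<Longrightarrow> v \<le> 5 * R \<Longrightarrow> wmass ?e {u..v} = ennreal (F v - F u)"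
    using wmass_primitive[OF we, of "- 5 * R" "5 * R"] by blast
  define G where "G z = F z - \<alpha> * z" for z
  have contG: "continuous_on {- 5 * R..5 * R} G" unfolding G_def by (intro continuous_intros F(1))
  have inn: "\<exists>y>z. y \<le> 5 * R \<and> G z < G y" if z: "z \<in> tauberian_set E \<alpha>" for z
  proof -
    obtain y where y: "z < y" "ennreal (\<alpha> * (y - z)) < wmass ?e {z..y}" using z iff by blast
    have b: "- 5 * R \<le> z" "y \<le> 5 * R" using tauberian_set_witness_bound[OF E \<alpha>(1) y] by auto
    have "\<alpha> * (y - z) < F y - F z" using y b F(3)[of z y] a0 by (simp add: ennreal_less_iff)
    then have "G z < G y" by (simp add: G_def algebra_simps)
    then show ?thesis using y(1) b by blast
  qed
  have out: "G y \<le> G q" if y: "q \<le> y" "y \<le> 5 * R" for y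
  proof (cases "q = y")
    case False
    then have "wmass ?e {q..y} \<le> ennreal (\<alpha> * (y - q))" using pq(3) y(1) unfolding iff not_ex
      by (meson not_less order_le_neq_trans)
    then have "F y - F q \<le> \<alpha> * (y - q)"
      using F(3)[of q y] y pR pq(1) a0 by (simp add: ennreal_le_iff)
    then show ?thesis by (simp add: G_def algebra_simps)
  qed simp
  have Gq: "G z \<le> G q" if z: "z \<in> {p<..<q}" for z
  proof -
    have "continuous_on {z..q} G" using z pR R by (intro continuous_on_subset[OF contG]) auto
    then obtain u where u: "u \<in> {z..q}" "\<And>y. y \<in> {z..q} \<Longrightarrow> G y \<le> G u"
      using continuous_attains_sup[of "{z..q}" G] z by auto
    have "u = q"
    proof (rule ccontr)
      assume "u \<noteq> q"
      then have "u \<in> tauberian_set E \<alpha>" using u z pq(2) by (auto simp: subset_iff)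
      then obtain y where y: "u < y" "y \<le> 5 * R" "G u < G y" using inn by blast
      show False
      proof (cases "y \<le> q")
        case True then show False using y u(1) u(2)[of y] by auto
      next
        case False
        then have "G y \<le> G q" using out y by auto
        then show False using y u(2)[of q] z by auto
      qed
    qed
    then show ?thesis using u z by auto
  qed
  have Gp: "G p \<le> G q"
  proof (rule continuous_le_on_closure[of "{p<..<q}" G p "G q"])
    show "continuous_on (closure {p<..<q}) G"
      using pq(1) pR R by (auto intro!: continuous_on_subset[OF contG])
  qed (use pq(1) Gq in auto)
  have "G x \<le> G q" using Gp Gq[of x] x by (cases "x = p \<or> x = q") auto
  then have "\<alpha> * (q - x) \<le> F q - F x" by (simp add: G_def algebra_simps)
  moreover have eE: "emeasure lebesgue (E \<inter> {x..q}) = ennreal (F q - F x)"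
    using F(3)[of x q] x pR R E by (simp add: wmass_indicator)
  moreover have "emeasure lebesgue ({x..q} - E) = emeasure lebesgue {x..q} - emeasure lebesgue (E \<inter> {x..q})"
  proof -
    have "{x..q} - E = {x..q} - (E \<inter> {x..q})" by auto
    moreover have "emeasure lebesgue ({x..q} - (E \<inter> {x..q}))
        = emeasure lebesgue {x..q} - emeasure lebesgue (E \<inter> {x..q})"
      using E eE by (intro emeasure_Diff) auto
    ultimately show ?thesis by simp
  qed
  ultimately show ?thesis using x F(2)[of x q] pR R
    by (simp add: ennreal_minus) (intro ennreal_leI, simp add: algebra_simps)
qed

text \<open>
  Decompose (p,q) into Whitney intervals towards q. The part of the complement of E in the k-th one is
  contained in [x_k,q), so its measure is at most 1 - \<alpha> times q - x_k, which is four times the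
  length of the next Whitney interval. That next interval is the gap needed for the
  estimate of sets of small measure.
\<close>

lemma wmass_tauberian_component_le:
  assumes w: "weight w" and A: "Ainf_plus_const w = ennreal A" "0 < A" and n: "4 * A \<le> real n + 1" "1 \<le> n"
    and E: "E \<in> sets lebesgue" "E \<subseteq> {- R..R}" and \<alpha>: "1 / 2 \<le> \<alpha>" "\<alpha> < 1"
    and pq: "p < q" "{p<..<q} \<subseteq> tauberian_set E \<alpha>" "q \<notin> tauberian_set E \<alpha>"
  shows "(\<integral>\<^sup>+x\<in>{p<..<q}. ennreal (w x) * indicator (- E) x \<partial>lebesgue)
    \<le> ennreal (18 * (1 - \<alpha>) powr (1 / (2 * real n))) * (\<integral>\<^sup>+x\<in>{p<..<q}. ennreal (w x) \<partial>lebesgue)"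
proof -
  define e where "e = 1 - \<alpha>"
  have e: "0 < e" "e \<le> 1" using \<alpha> by (auto simp: e_def)
  obtain j where j: "2 ^ (n * j) * (4 * e) + (1 / 2) ^ j \<le> 6 * e powr (1 / (2 * real n))"
    using exists_dyadic_balance[OF e n(2)] by blast
  let ?C = "ennreal (6 * e powr (1 / (2 * real n)))"
  let ?x = "whitney_point p q"
  note wm = weight_measurable_ennreal[OF w]
  have "(\<integral>\<^sup>+x\<in>{p..<q}. ennreal (w x) * indicator (- E) x \<partial>lebesgue)
      \<le> 3 * ?C * (\<integral>\<^sup>+x\<in>{p..<q}. ennreal (w x) \<partial>lebesgue)"
  proof (rule set_nn_integral_le_by_whitney[OF pq(1) _ wm])
    show "(\<lambda>x. ennreal (w x) * indicator (- E) x) \<in> borel_measurable lebesgue"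
      using wm E(1) by (intro borel_measurable_times_ennreal borel_measurable_indicator) (auto simp: Compl_in_sets_lebesgue)
    fix k
    let ?D = "{?x k<..<?x (Suc k)} - E"
    have ord: "?x k < ?x (Suc k)" "?x (Suc k) < ?x (k + 2)" "?x (k - 1) \<le> ?x k"
      using pq(1) by (auto intro: whitney_point_less whitney_point_le)
    have "emeasure lebesgue ?D \<le> emeasure lebesgue ({?x k..q} - E)"
      using E whitney_point_bounds[OF pq(1), of "Suc k"] by (intro emeasure_mono) auto
    also have "\<dots> \<le> ennreal (e * (q - ?x k))"
      unfolding e_def using whitney_point_bounds[OF pq(1), of k]
      by (intro tauberian_set_component[OF E \<alpha> pq]) auto
    also have "q - ?x k = 4 * (?x (k + 2) - ?x (Suc k))"
      by (simp add: whitney_point_def field_simps)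
    finally have D: "emeasure lebesgue ?D \<le> ennreal (4 * e * (?x (k + 2) - ?x (Suc k)))"
      by (simp add: ac_simps)
    have "(\<integral>\<^sup>+x\<in>{?x k..<?x (Suc k)}. ennreal (w x) * indicator (- E) x \<partial>lebesgue)
        = (\<integral>\<^sup>+x\<in>{?x k<..<?x (Suc k)}. ennreal (w x) * indicator (- E) x \<partial>lebesgue)"
      by (rule set_nn_integral_cong_endpoints[of _ "?x k" "?x k"]) auto
    also have "\<dots> = wmass w ?D"
      unfolding wmass_def by (intro nn_integral_cong) (auto simp: indicator_def)
    also have "\<dots> \<le> ennreal (2 ^ (n * j) * (4 * e) + (1 / 2) ^ j) * wmass w {?x k..?x (k + 2)}"
      using ord E e D by (intro wmass_small_set_le[OF w A n(1)]) auto
    also have "\<dots> \<le> ?C * wmass w {?x (k - 1)..?x (k + 2)}"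
      using j ord by (intro mult_mono ennreal_leI wmass_mono) auto
    also have "wmass w {?x (k - 1)..?x (k + 2)} = wmass w {?x (k - 1)..<?x (k + 2)}"
      by (simp add: wmass_interval_eq)
    finally show "(\<integral>\<^sup>+x\<in>{?x k..<?x (Suc k)}. ennreal (w x) * indicator (- E) x \<partial>lebesgue)
        \<le> ?C * (\<integral>\<^sup>+x\<in>{?x (k - 1)..<?x (k + 2)}. ennreal (w x) \<partial>lebesgue)"
      by (simp add: wmass_def)
  qed
  moreover have "3 * ?C = ennreal (18 * e powr (1 / (2 * real n)))"
    by (subst ennreal_numeral[symmetric], subst ennreal_mult[symmetric]) auto
  moreover have "(\<integral>\<^sup>+x\<in>{p..<q}. f x \<partial>lebesgue) = (\<integral>\<^sup>+x\<in>{p<..<q}. f x \<partial>lebesgue)" for f :: "real \<Rightarrow> ennreal"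
    by (rule set_nn_integral_cong_endpoints[of _ p p]) auto
  ultimately show ?thesis by (simp add: e_def)
qed

lemma wmass_tauberian_set_bounded_le:
  assumes w: "weight w" and A: "Ainf_plus_const w = ennreal A" "0 < A" and n: "4 * A \<le> real n + 1" "1 \<le> n"
    and E: "E \<in> sets lebesgue" "E \<subseteq> {- R..R}" and \<alpha>: "1 / 2 \<le> \<alpha>" "\<alpha> < 1"
    and small: "18 * (1 - \<alpha>) powr (1 / (2 * real n)) \<le> 1 / 2"
  shows "wmass w (tauberian_set E \<alpha>) \<le> ennreal (1 + 36 * (1 - \<alpha>) powr (1 / (2 * real n))) * wmass w E"
proof -
  define \<theta> where "\<theta> = 18 * (1 - \<alpha>) powr (1 / (2 * real n))"
  have \<theta>: "0 \<le> \<theta>" "\<theta> \<le> 1 / 2" using small by (auto simp: \<theta>_def)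
  let ?U = "tauberian_set E \<alpha>"
  note wm = weight_measurable_ennreal[OF w]
  have U: "open ?U" using E \<alpha> by (intro open_tauberian_set) auto
  have Ub: "?U \<subseteq> {- 5 * R..R}" by (rule tauberian_set_subset[OF E \<alpha>(1)])
  have "(\<integral>\<^sup>+x\<in>?U. ennreal (w x) * indicator (- E) x \<partial>lebesgue) \<le> ennreal \<theta> * (\<integral>\<^sup>+x\<in>?U. ennreal (w x) \<partial>lebesgue)"
    unfolding \<theta>_def
  proof (rule set_nn_integral_le_by_components[OF U _ _ wm])
    show "bounded ?U" by (rule bounded_subset[OF _ Ub]) simp
    show "(\<lambda>x. ennreal (w x) * indicator (- E) x) \<in> borel_measurable lebesgue"
      using wm E(1) by (intro borel_measurable_times_ennreal borel_measurable_indicator) (auto simp: Compl_in_sets_lebesgue)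
  qed (rule wmass_tauberian_component_le[OF w A n E \<alpha>])
  moreover have "(\<integral>\<^sup>+x\<in>?U. ennreal (w x) * indicator (- E) x \<partial>lebesgue) = wmass w (?U - E)"
    unfolding wmass_def by (intro nn_integral_cong) (auto simp: indicator_def)
  ultimately have diff: "wmass w (?U - E) \<le> ennreal \<theta> * wmass w ?U" by (simp add: wmass_def)
  have "wmass w ?U \<le> wmass w (E \<union> (?U - E))" by (rule wmass_mono) auto
  also have "\<dots> \<le> wmass w E + wmass w (?U - E)" using E U by (intro wmass_subadditive w) auto
  also have "\<dots> \<le> wmass w E + ennreal \<theta> * wmass w ?U" using diff by (rule add_left_mono)
  \<comment> \<open>As the mass of U is finite, the last term can be absorbed on the left.\<close>
  finally have main: "wmass w ?U \<le> wmass w E + ennreal \<theta> * wmass w ?U" .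
  have "wmass w ?U < \<infinity>" using le_less_trans[OF wmass_mono[OF Ub] wmass_Icc_finite[OF w]] .
  then obtain u where u: "wmass w ?U = ennreal u" "0 \<le> u" by (cases "wmass w ?U") auto
  have "wmass w E < \<infinity>" using le_less_trans[OF wmass_mono[OF E(2)] wmass_Icc_finite[OF w]] .
  then obtain v where v: "wmass w E = ennreal v" "0 \<le> v" by (cases "wmass w E") auto
  have "ennreal u \<le> ennreal (v + \<theta> * u)" using main u v \<theta> by (simp add: ennreal_mult)
  then have "u \<le> v + \<theta> * u" using v u \<theta> by (subst (asm) ennreal_le_iff) auto
  then have uv: "u * (1 - \<theta>) \<le> v" by (simp add: algebra_simps)
  have "u \<le> (1 + 2 * \<theta>) * (u * (1 - \<theta>))"
  proof -
    have "0 \<le> u * (\<theta> * (1 - 2 * \<theta>))" using u \<theta> by (intro mult_nonneg_nonneg) auto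
    then show ?thesis by (simp add: algebra_simps)
  qed
  also have "\<dots> \<le> (1 + 2 * \<theta>) * v" using uv \<theta> by (intro mult_left_mono) auto
  finally have "ennreal u \<le> ennreal (1 + 2 * \<theta>) * ennreal v"
    using \<theta> v by (subst ennreal_mult[symmetric]) (auto intro: ennreal_leI)
  then show ?thesis by (simp add: u v \<theta>_def)
qed

text \<open>
  Truncating E to [-k,k] exhausts the tauberian set, since a single average that exceeds \<alpha> involves
  only a bounded part of E. Bounded E is what makes components bounded and masses finite.
\<close>

lemma wmass_tauberian_set_le:
  assumes w: "weight w" and A: "Ainf_plus_const w = ennreal A" "0 < A" and n: "4 * A \<le> real n + 1" "1 \<le> n"
    and E: "E \<in> sets lebesgue" and \<alpha>: "1 / 2 \<le> \<alpha>" "\<alpha> < 1"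
    and small: "18 * (1 - \<alpha>) powr (1 / (2 * real n)) \<le> 1 / 2"
  shows "wmass w (tauberian_set E \<alpha>) \<le> ennreal (1 + 36 * (1 - \<alpha>) powr (1 / (2 * real n))) * wmass w E"
proof -
  have a0: "0 \<le> \<alpha>" using \<alpha> by simp
  define T where "T k = E \<inter> {- real k..real k}" for k
  have T: "T k \<in> sets lebesgue" "T k \<subseteq> {- real k..real k}" "T k \<subseteq> E" for k using E by (auto simp: T_def)
  have mono: "tauberian_set (T i) \<alpha> \<subseteq> tauberian_set (T j) \<alpha>" if "i \<le> j" for i j
  proof
    fix x assume "x \<in> tauberian_set (T i) \<alpha>"
    then obtain y where y: "x < y" "ennreal (\<alpha> * (y - x)) < wmass (indicator (T i)) {x..y}"
      using tauberian_set_iff[OF T(1) a0] by blast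
    have "wmass (indicator (T i)) {x..y} \<le> wmass (indicator (T j)) {x..y}"
      unfolding wmass_def using that by (intro nn_integral_mono) (auto simp: T_def indicator_def)
    then show "x \<in> tauberian_set (T j) \<alpha>"
      using y tauberian_set_iff[OF T(1) a0] less_le_trans by blast
  qed
  have sub: "tauberian_set E \<alpha> \<subseteq> (\<Union>k. tauberian_set (T k) \<alpha>)"
  proof
    fix x assume "x \<in> tauberian_set E \<alpha>"
    then obtain y where y: "x < y" "ennreal (\<alpha> * (y - x)) < wmass (indicator E) {x..y}"
      using tauberian_set_iff[OF E a0] by blast
    obtain k :: nat where "max \<bar>x\<bar> \<bar>y\<bar> \<le> real k" using real_arch_simple by blast
    then have "wmass (indicator E) {x..y} = wmass (indicator (T k)) {x..y}"
      unfolding wmass_def by (intro nn_integral_cong) (auto simp: T_def indicator_def)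
    then show "x \<in> (\<Union>k. tauberian_set (T k) \<alpha>)"
      using y tauberian_set_iff[OF T(1) a0] by auto
  qed
  have meas: "tauberian_set (T k) \<alpha> \<in> sets lebesgue" for k
    using open_tauberian_set[OF T(1) a0] by auto
  have "wmass w (tauberian_set E \<alpha>) \<le> wmass w (\<Union>k. tauberian_set (T k) \<alpha>)" by (rule wmass_mono[OF sub])
  also have "\<dots> = (SUP k. wmass w (tauberian_set (T k) \<alpha>))"
    using meas mono by (simp add: wmass_eq_emeasure[OF w] sets.countable_UN
        SUP_emeasure_incseq[symmetric] incseq_def image_subset_iff)
  also have "\<dots> \<le> ennreal (1 + 36 * (1 - \<alpha>) powr (1 / (2 * real n))) * wmass w E"
  proof (rule SUP_least)
    fix k
    have "wmass w (tauberian_set (T k) \<alpha>)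
        \<le> ennreal (1 + 36 * (1 - \<alpha>) powr (1 / (2 * real n))) * wmass w (T k)"
      by (rule wmass_tauberian_set_bounded_le[OF w A n T(1,2) \<alpha> small])
    also have "\<dots> \<le> ennreal (1 + 36 * (1 - \<alpha>) powr (1 / (2 * real n))) * wmass w E"
      by (intro mult_left_mono wmass_mono T) simp
    finally show "wmass w (tauberian_set (T k) \<alpha>)
        \<le> ennreal (1 + 36 * (1 - \<alpha>) powr (1 / (2 * real n))) * wmass w E" .
  qed
  finally show ?thesis .
qed

text \<open>
  The constant 40: with A at least 1 one may take n at most 5 A, so the exponent 1/(2 n) is at
  least 1/(10 A). For 1 - \<alpha> below exp(-40 A) this power is at most exp(-4), which brings 18 times
  it below 1/2.
\<close>

lemma tauberian_plus_le_of_Ainf: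
  assumes w: "w \<in> Ainf_plus" and nz: "\<not> (AE x in lebesgue. w x = 0)"
    and \<alpha>: "\<alpha> < 1" "1 - exp (- (40 * enn2real (Ainf_plus_const w))) < \<alpha>"
  shows "tauberian_plus w \<alpha> - 1
    \<le> ennreal (36 * (1 - \<alpha>) powr inverse (40 * enn2real (Ainf_plus_const w)))"
proof -
  define A where "A = enn2real (Ainf_plus_const w)"
  have ww: "weight w" and fin: "Ainf_plus_const w < \<infinity>" using w by (auto simp: Ainf_plus_def)
  have A: "Ainf_plus_const w = ennreal A" using fin by (simp add: A_def)
  have A1: "1 \<le> A" using Ainf_plus_const_ge_1[OF ww nz] A by simp
  define n where "n = nat \<lceil>4 * A\<rceil>"
  have n: "4 * A \<le> real n" "real n \<le> 4 * A + 1" using A1 unfolding n_def by linarith+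
  have n': "4 * A \<le> real n + 1" "1 \<le> n" using n A1 by linarith+
  define e where "e = 1 - \<alpha>"
  have e: "0 < e" "e < exp (- (40 * A))" using \<alpha> by (auto simp: e_def A_def)
  have e36: "exp (- (4::real)) \<le> 1 / 36"
  proof -
    have "(36::real) \<le> (1 + 4 / real 32) ^ 32" by (simp add: power_divide)
    also have "\<dots> \<le> exp 4" by (rule exp_ge_one_plus_x_over_n_power_n) auto
    finally show ?thesis by (simp add: exp_minus field_simps)
  qed
  have e1: "e \<le> 1 / 36"
  proof -
    have "exp (- (40 * A)) \<le> exp (- 4)" using A1 by simp
    then show ?thesis using e e36 by linarith
  qed
  have exps: "inverse (40 * A) \<le> 1 / (2 * real n)" "1 / (10 * A) \<le> 1 / (2 * real n)"
    using n A1 by (auto simp: field_simps)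
  have "e powr (1 / (2 * real n)) \<le> e powr (1 / (10 * A))"
    using e e1 exps by (intro powr_mono') auto
  also have "\<dots> \<le> exp (- (40 * A)) powr (1 / (10 * A))"
    using e A1 by (intro powr_mono2) auto
  also have "\<dots> = exp (- 4)" using A1 by (simp add: powr_def)
  finally have small: "18 * (1 - \<alpha>) powr (1 / (2 * real n)) \<le> 1 / 2" using e36 by (simp add: e_def)
  have "tauberian_plus w \<alpha> \<le> ennreal (1 + 36 * e powr (1 / (2 * real n)))"
    unfolding tauberian_plus_def
  proof (rule SUP_least)
    fix E assume E: "E \<in> {E \<in> sets lebesgue. 0 < wmass w E \<and> wmass w E < \<infinity>}"
    have "wmass w (tauberian_set E \<alpha>) / wmass w E
        \<le> ennreal (1 + 36 * e powr (1 / (2 * real n))) * wmass w E / wmass w E"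
      unfolding e_def using E e e1 A1 small \<alpha> A n'
      by (intro divide_right_mono_ennreal wmass_tauberian_set_le[OF ww A _ n']) (auto simp: e_def)
    also have "\<dots> = ennreal (1 + 36 * e powr (1 / (2 * real n)))"
      using E by (intro ennreal_mult_divide_eq) auto
    finally show "wmass w {x. ennreal \<alpha> < M_plus (indicator E) x} / wmass w E
        \<le> ennreal (1 + 36 * e powr (1 / (2 * real n)))"
      by (simp add: tauberian_set_def)
  qed
  also have "\<dots> \<le> ennreal (1 + 36 * e powr inverse (40 * A))"
    using e e1 exps by (intro ennreal_leI add_left_mono mult_left_mono powr_mono') auto
  also have "\<dots> = 1 + ennreal (36 * e powr inverse (40 * A))" by (simp add: ennreal_plus)
  finally show ?thesis by (simp add: ennreal_minus_le_iff A_def e_def)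
qed

section \<open>Level sets under a tauberian hypothesis\<close>

lemma weight_mult_indicator:
  assumes w: "weight w" and F: "F \<in> sets lebesgue"
  shows "weight (\<lambda>x. w x * indicator F x)"
  unfolding weight_def locally_integrable_def
proof (intro conjI allI impI)
  show "0 \<le> w x * indicator F x" for x using w by (simp add: weight_def)
  fix K :: "real set" assume K: "compact K"
  have "set_integrable lebesgue (K \<inter> F) w"
    using K F w by (intro set_integrable_subset[of lebesgue K w "K \<inter> F"])
      (auto simp: weight_def locally_integrable_def borel_compact)
  moreover have "(\<lambda>x. indicator (K \<inter> F) x *\<^sub>R w x) = (\<lambda>x. indicator K x *\<^sub>R (w x * indicator F x))"
    by (auto simp: indicator_def)
  ultimately show "(\<lambda>x. w x * indicator F x) absolutely_integrable_on K"
    by (simp add: set_integrable_def)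
qed

lemma wmass_mult_indicator: "wmass (\<lambda>x. w x * indicator F x) S = wmass w (F \<inter> S)"
  unfolding wmass_def by (intro nn_integral_cong) (auto simp: indicator_def)

text \<open>
  Test the tauberian constant with E = (p,q) minus F. A set F to the left of m that is short compared
  with (m,q) cannot push any average over (x,q) down to 1 - e, so the tauberian set of E contains (p,q):
  removing F has not changed the mass of the tauberian set, hence F carries at most a fraction k of the
  mass of E. The one obstacle is that E must have positive mass. If the estimate failed for F,
  it would also fail for some part of F lying to the left of a point s, and by continuity s can
  be chosen such that the complement of that part has positive mass.
\<close>

lemma wmass_small_set_le_of_tauberian:
  assumes w: "weight w" and e: "0 < e" "e < 1" and k: "0 \<le> k"
    and taub: "tauberian_plus w (1 - e) - 1 \<le> ennreal k"
    and pmq: "p < m" "m < q" and F: "F \<in> sets lebesgue" "F \<subseteq> {p<..m}"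
    and small: "emeasure lebesgue F < ennreal (e * (q - m))"
  shows "wmass w F \<le> ennreal k * wmass w {p..q}"
proof (rule ccontr)
  assume contra: "\<not> ?thesis"
  obtain M where M: "wmass w {p..q} = ennreal M" "0 \<le> M"
    using wmass_Icc_finite[OF w, of p q] by (cases "wmass w {p..q}") auto
  have mono: "wmass w S \<le> ennreal M" if "S \<subseteq> {p..q}" for S using wmass_mono[OF that, of w] M by simp
  have "F \<subseteq> {p..q}" using F pmq by auto
  from mono[OF this] obtain f where f: "wmass w F = ennreal f" "0 \<le> f" "f \<le> M"
    using M by (cases "wmass w F") (auto simp: top_unique)
  have "k * M < f" using contra f M k by (simp add: ennreal_mult[symmetric] not_le ennreal_less_iff)
  then have kf: "k * M < (1 + k) * f" using f k
    by (metis add_strict_increasing2 distrib_right mult_1 mult_nonneg_nonneg add.commute)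
  have step: "(1 + k) * f' \<le> k * M"
    if F': "F' \<in> sets lebesgue" "F' \<subseteq> F" "wmass w F' = ennreal f'" "0 \<le> f'" "f' < M" for F' f'
  proof -
    let ?E = "{p<..<q} - F'"
    have E: "?E \<in> sets lebesgue" using F' by auto
    have split: "wmass w ?E + ennreal f' = ennreal M"
    proof -
      have "?E \<union> F' = {p<..<q}" using F' F pmq by auto
      then have "wmass w {p<..<q} = wmass w ?E + wmass w F'"
        using wmass_Un[OF w E F'(1)] by (metis Diff_disjoint Int_commute)
      then show ?thesis using F' M by (simp add: wmass_interval_eq)
    qed
    then obtain g where g: "wmass w ?E = ennreal g" "0 \<le> g" by (cases "wmass w ?E") auto
    have gM: "g + f' = M" using split g F' M by (simp flip: ennreal_plus)
    have sub: "{p<..<q} \<subseteq> tauberian_set ?E (1 - e)"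
    proof
      fix x assume x: "x \<in> {p<..<q}"
      have "emeasure lebesgue (F' \<inter> {x..q}) < ennreal (e * (q - x))"
      proof (cases "x \<le> m")
        case True
        have "emeasure lebesgue (F' \<inter> {x..q}) \<le> emeasure lebesgue F"
          using F' F by (intro emeasure_mono) auto
        also note small
        also have "ennreal (e * (q - m)) \<le> ennreal (e * (q - x))"
          using True e by (intro ennreal_leI mult_left_mono) auto
        finally show ?thesis .
      next
        case False
        then have "F' \<inter> {x..q} = {}" using F' F by auto
        then show ?thesis using e x by simp
      qed
      moreover have "ennreal (q - x) \<le> emeasure lebesgue (?E \<inter> {x..q}) + emeasure lebesgue (F' \<inter> {x..q})"
      proof -
        have "ennreal (q - x) = emeasure lebesgue {x<..<q}" using x by simp
        also have "\<dots> \<le> emeasure lebesgue ((?E \<inter> {x..q}) \<union> (F' \<inter> {x..q}))"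
          using x F' E by (intro emeasure_mono sets.Un sets.Int) auto
        also have "\<dots> \<le> emeasure lebesgue (?E \<inter> {x..q}) + emeasure lebesgue (F' \<inter> {x..q})"
          using E F' by (intro emeasure_subadditive) auto
        finally show ?thesis .
      qed
      ultimately have "ennreal ((1 - e) * (q - x)) < emeasure lebesgue (?E \<inter> {x..q})"
      proof -
        assume 1: "emeasure lebesgue (F' \<inter> {x..q}) < ennreal (e * (q - x))"
          and 2: "ennreal (q - x) \<le> emeasure lebesgue (?E \<inter> {x..q}) + emeasure lebesgue (F' \<inter> {x..q})"
        obtain u where u: "emeasure lebesgue (F' \<inter> {x..q}) = ennreal u" "0 \<le> u"
          using 1 by (cases "emeasure lebesgue (F' \<inter> {x..q})") auto
        show ?thesis
        proof (cases "emeasure lebesgue (?E \<inter> {x..q})")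
          case (real v)
          have "u < e * (q - x)" using 1 u by (simp add: ennreal_less_iff)
          moreover have "q - x \<le> v + u" using 2 u real by (simp flip: ennreal_plus)
          ultimately have "(1 - e) * (q - x) < v" by (simp add: algebra_simps)
          then show ?thesis using real e x by (simp add: ennreal_less_iff)
        qed simp
      qed
      moreover have "wmass (indicator ?E) {x..q} = emeasure lebesgue (?E \<inter> {x..q})"
        using E by (intro wmass_indicator) auto
      ultimately show "x \<in> tauberian_set ?E (1 - e)"
        using x e by (subst tauberian_set_iff[OF E]) auto
    qed
    have "wmass w (tauberian_set ?E (1 - e)) / wmass w ?E \<le> tauberian_plus w (1 - e)"
      unfolding tauberian_plus_def tauberian_set_def using E g gM F'
      by (intro SUP_upper) auto
    also have "\<dots> \<le> ennreal (1 + k)" using taub k by (simp add: ennreal_minus_le_iff ennreal_plus)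
    finally have "wmass w (tauberian_set ?E (1 - e)) / ennreal g * ennreal g \<le> ennreal (1 + k) * ennreal g"
      unfolding g(1) by (rule mult_right_mono) simp
    moreover have "wmass w (tauberian_set ?E (1 - e)) / ennreal g * ennreal g = wmass w (tauberian_set ?E (1 - e))"
    proof -
      have "0 < g" using gM F'(5) by linarith
      then show ?thesis by (simp add: ennreal_divide_times ennreal_divide_self)
    qed
    ultimately have "wmass w (tauberian_set ?E (1 - e)) \<le> ennreal (1 + k) * ennreal g" by simp
    moreover have "ennreal M \<le> wmass w (tauberian_set ?E (1 - e))"
      using wmass_mono[OF sub, of w] M by (simp add: wmass_interval_eq)
    ultimately have "ennreal M \<le> ennreal ((1 + k) * g)"
      using k g by (subst ennreal_mult) (auto intro: order_trans)
    then have "M \<le> (1 + k) * g" using k g by (subst (asm) ennreal_le_iff) auto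
    then show ?thesis using gM by (simp add: algebra_simps flip: gM)
  qed
  \<comment> \<open>A mass strictly between k M / (1 + k), which is all that the tauberian bound permits, and f.\<close>
  define \<tau> where "\<tau> = (k * M / (1 + k) + f) / 2"
  have kf': "k * M / (1 + k) < f" using kf k by (simp add: pos_divide_less_eq mult.commute)
  have \<tau>: "k * M / (1 + k) < \<tau>" "\<tau> < f" "0 \<le> \<tau>"
  proof -
    have "0 \<le> k * M / (1 + k)" using k M by simp
    then show "0 \<le> \<tau>" using f(2) by (simp add: \<tau>_def)
    show "k * M / (1 + k) < \<tau>" "\<tau> < f"
      using less_half_sum[OF kf'] gt_half_sum[OF kf'] by (auto simp: \<tau>_def)
  qed
  obtain P where P: "continuous_on {p..m} P"
    "\<And>x y. p \<le> x \<Longrightarrow> x \<le> y \<Longrightarrow> y \<le> m \<Longrightarrow> P x \<le> P y"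
    "\<And>x y. p \<le> x \<Longrightarrow> x \<le> y \<Longrightarrow> y \<le> m \<Longrightarrow> wmass (\<lambda>x. w x * indicator F x) {x..y} = ennreal (P y - P x)"
    using wmass_primitive[OF weight_mult_indicator[OF w F(1)], of p m] by blast
  have Pm: "wmass w (F \<inter> {p..s}) = ennreal (P s - P p)" if "p \<le> s" "s \<le> m" for s
    using P(3)[of p s] that by (simp add: wmass_mult_indicator)
  have "F \<inter> {p..m} = F" using F by auto
  then have "P m - P p = f" using Pm[of m] P(2)[of p m] pmq f by simp
  then have "\<exists>s. p \<le> s \<and> s \<le> m \<and> P s = P p + \<tau>"
    using \<tau> pmq by (intro IVT'[OF _ _ _ P(1)]) auto
  then obtain s where s: "p \<le> s" "s \<le> m" "P s - P p = \<tau>" by auto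
  have "(1 + k) * \<tau> \<le> k * M"
    using s Pm[of s] \<tau> f F by (intro step[of "F \<inter> {p..s}"]) auto
  then show False using \<tau>(1) k by (simp add: pos_divide_less_eq mult.commute)
qed

text \<open>
  Why mass moves down the level sets. Inside a component (p,q) at height l, the higher level set has
  length at most (q - p) / L. Its part in the first three quarters is small by the tauberian hypothesis,
  with the last quarter serving as gap. In the last quarter the tauberian hypothesis says
  nothing, but there the rising sun lemma bounds the whole mass of w by a quarter
  of the mass of (p,q).
\<close>

lemma level_set_component_half:
  assumes w: "weight w" and e: "0 < e" "e < 1"
    and taub: "tauberian_plus w (1 - e) - 1 \<le> ennreal (1 / 4)"
    and L: "4 < e * L" and l: "0 < l" and at: "a < t" and t: "left_max w a t \<le> ennreal l"
    and pq: "p < q" "{p<..<q} \<subseteq> level_set w a t l" "p \<notin> level_set w a t l" "q \<notin> level_set w a t l"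
  shows "wmass w (level_set w a t (L * l) \<inter> {p<..<q}) \<le> ennreal (1 / 2) * wmass w {p..q}"
proof -
  have L0: "1 < L"
  proof (rule ccontr)
    assume "\<not> 1 < L"
    then have "L \<le> 1" by simp
    then have "e * L \<le> e * 1" using e by (intro mult_left_mono) auto
    then show False using L e by linarith
  qed
  have Ll: "0 \<le> L * l" "0 < L * l" "l \<le> L * l" using L0 l by auto
  note comp = level_set_component[OF w less_imp_le[OF l] at t pq]
  let ?O = "level_set w p q (L * l)"
  have sub: "{p<..<q} \<subseteq> {a<..<t}" using comp(4,5) by auto
  have OO: "level_set w a t (L * l) \<inter> {p<..<q} = ?O"
    using comp(3) sub by (auto simp: level_set_def)
  have ql: "left_max w p q \<le> ennreal (L * l)"
  proof -
    have "left_max w p q \<le> left_max w a q"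
      unfolding left_max_def using comp(4) by (intro SUP_subset_mono) auto
    also have "\<dots> \<le> ennreal l"
      using pq(1,4) t comp(4,5) by (cases "q = t") (auto simp: level_set_def not_less)
    finally show ?thesis using Ll by (meson ennreal_leI order_trans)
  qed
  have op: "open ?O" by (rule open_level_set[OF w Ll(1)])
  have OI: "?O \<subseteq> {p..q}" by (auto simp: level_set_def)
  \<comment> \<open>The last quarter (m,q) is the gap.\<close>
  define m where "m = q - (q - p) / 4"
  have m: "p < m" "m < q" "q - m = (q - p) / 4" using pq(1) by (auto simp: m_def field_simps)
  have "ennreal (L * l) * emeasure lebesgue ?O \<le> ennreal (l * (q - p))"
    unfolding wmass_level_set[OF w Ll(1) pq(1) ql, symmetric] comp(1)[symmetric]
    by (rule wmass_mono[OF OI])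
  moreover have "emeasure lebesgue ?O \<le> emeasure lebesgue {p..q}"
    by (rule emeasure_mono[OF OI]) simp
  then have "emeasure lebesgue ?O < \<infinity>" using pq(1) by (auto intro: le_less_trans)
  then obtain v where v: "emeasure lebesgue ?O = ennreal v" "0 \<le> v" by (cases "emeasure lebesgue ?O") auto
  ultimately have "L * l * v \<le> l * (q - p)" using Ll l pq(1) by (simp add: ennreal_mult[symmetric])
  then have "L * v \<le> q - p" using l by simp
  then have "e * L * v \<le> e * (q - p)" using e by simp
  moreover have "v = 0 \<or> 4 * v < e * L * v" using L v by (cases "v = 0") auto
  moreover have "0 < e * (q - p)" "e * (q - m) = e * (q - p) / 4" using e pq(1) by (simp_all add: m(3))
  ultimately have "v < e * (q - m)" by linarith
  have "emeasure lebesgue (?O \<inter> {p<..m}) \<le> ennreal v"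
    unfolding v(1)[symmetric] using op by (intro emeasure_mono) auto
  also have "\<dots> < ennreal (e * (q - m))" using \<open>v < e * (q - m)\<close> v(2) by (simp add: ennreal_less_iff)
  finally have small: "emeasure lebesgue (?O \<inter> {p<..m}) < ennreal (e * (q - m))" .
  have 1: "wmass w (?O \<inter> {p<..m}) \<le> ennreal (1 / 4) * wmass w {p..q}"
    by (rule wmass_small_set_le_of_tauberian[OF w e _ taub m(1,2) _ _ small]) (use op in auto)
  have 2: "wmass w {m..q} \<le> ennreal (1 / 4) * wmass w {p..q}"
  proof -
    have "wmass w {m..q} \<le> ennreal (l * (q - m))" using m by (intro comp(2)) auto
    also have "\<dots> = ennreal (1 / 4) * wmass w {p..q}"
      using l pq(1) by (simp add: comp(1) m(3) ennreal_mult[symmetric] del: ennreal_divide_numeral)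
    finally show ?thesis .
  qed
  have "?O \<subseteq> (?O \<inter> {p<..m}) \<union> {m..q}" by (auto simp: level_set_def)
  then have "wmass w ?O \<le> wmass w (?O \<inter> {p<..m}) + wmass w {m..q}"
    using op by (intro order_trans[OF wmass_mono wmass_subadditive[OF w]]) auto
  also have "\<dots> \<le> ennreal (1 / 4) * wmass w {p..q} + ennreal (1 / 4) * wmass w {p..q}"
    by (intro add_mono 1 2)
  also have "\<dots> = (ennreal (1 / 4) + ennreal (1 / 4)) * wmass w {p..q}" by (simp only: distrib_right)
  also have "ennreal (1 / 4) + ennreal (1 / 4) = ennreal (1 / 2)" by (subst ennreal_plus[symmetric]) auto
  finally show ?thesis unfolding OO .
qed

lemma level_set_halving_of_tauberian:
  assumes w: "weight w" and e: "0 < e" "e < 1"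
    and taub: "tauberian_plus w (1 - e) - 1 \<le> ennreal (1 / 4)"
    and L: "4 < e * L" and l: "0 < l" and at: "a < t" and t: "left_max w a t \<le> ennreal l"
  shows "wmass w (level_set w a t (L * l)) \<le> ennreal (1 / 2) * wmass w (level_set w a t l)"
proof -
  let ?O = "level_set w a t l" and ?V = "level_set w a t (L * l)"
  have L0: "1 < L"
  proof (rule ccontr)
    assume "\<not> 1 < L"
    then have "L \<le> 1" by simp
    then have "e * L \<le> e * 1" using e by (intro mult_left_mono) auto
    then show False using L e by linarith
  qed
  have Ll: "0 \<le> L * l" "l \<le> L * l" using L0 l by auto
  note wm = weight_measurable_ennreal[OF w]
  have opV: "open ?V" by (rule open_level_set[OF w Ll(1)])
  have "(\<integral>\<^sup>+x\<in>?O. ennreal (w x) * indicator ?V x \<partial>lebesgue)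
      \<le> ennreal (1 / 2) * (\<integral>\<^sup>+x\<in>?O. ennreal (w x) \<partial>lebesgue)"
  proof (rule set_nn_integral_le_by_components[OF open_level_set[OF w] bounded_level_set _ wm])
    show "0 \<le> l" using l by simp
    show "(\<lambda>x. ennreal (w x) * indicator ?V x) \<in> borel_measurable lebesgue"
      using opV wm by (intro borel_measurable_times_ennreal borel_measurable_indicator) auto
    fix p q assume pq: "p < q" "{p<..<q} \<subseteq> ?O" "p \<notin> ?O" "q \<notin> ?O"
    have "(\<integral>\<^sup>+x\<in>{p<..<q}. ennreal (w x) * indicator ?V x \<partial>lebesgue) = wmass w (?V \<inter> {p<..<q})"
      unfolding wmass_def by (intro nn_integral_cong) (auto simp: indicator_def)
    also have "\<dots> \<le> ennreal (1 / 2) * wmass w {p<..<q}"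
      using level_set_component_half[OF w e taub L l at t pq] by (simp add: wmass_interval_eq)
    finally show "(\<integral>\<^sup>+x\<in>{p<..<q}. ennreal (w x) * indicator ?V x \<partial>lebesgue)
        \<le> ennreal (1 / 2) * (\<integral>\<^sup>+x\<in>{p<..<q}. ennreal (w x) \<partial>lebesgue)"
      by (simp add: wmass_def)
  qed
  moreover have "(\<integral>\<^sup>+x\<in>?O. ennreal (w x) * indicator ?V x \<partial>lebesgue) = wmass w ?V"
    unfolding wmass_def using level_set_antimono[OF Ll(2), of w a t]
    by (intro nn_integral_cong) (auto simp: indicator_def)
  ultimately show ?thesis by (simp add: wmass_def)
qed

lemma suminf_le_of_periodic_halving:
  fixes u :: "nat \<Rightarrow> ennreal"
  assumes le: "\<And>k. u k \<le> ennreal m" and m: "0 \<le> m"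
    and half: "\<And>k. u (n + k) \<le> ennreal (1 / 2) * u k"
  shows "(\<Sum>k. u k) \<le> ennreal (2 * real n * m)"
proof -
  define r where "r k = enn2real (u k)" for k
  have u: "u k = ennreal (r k)" and r0: "0 \<le> r k" for k
    using le[of k] by (auto simp: r_def ennreal_enn2real_if top_unique)
  have rm: "r k \<le> m" for k using le[of k] m by (simp add: u r0)
  have rh: "r (n + k) \<le> r k / 2" for k
  proof -
    have "ennreal (r (n + k)) \<le> ennreal (1 / 2 * r k)"
      using half[of k] r0 unfolding u by (subst ennreal_mult) auto
    then show ?thesis using r0 by (subst (asm) ennreal_le_iff) auto
  qed
  \<comment> \<open>Finite partial sums are used, since the shifted tail is subtracted.\<close>
  have bound: "(\<Sum>k<N. r k) \<le> 2 * real n * m" for N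
  proof -
    have "(\<Sum>k<N. r k) \<le> (\<Sum>k<n + N. r k)" using r0 by (intro sum_mono2) auto
    also have "\<dots> = (\<Sum>k<n. r k) + (\<Sum>k<N. r (n + k))"
      by (induction N) (auto simp: ac_simps)
    also have "\<dots> \<le> (\<Sum>k<n. m) + (\<Sum>k<N. r k / 2)" by (intro add_mono sum_mono rm rh)
    also have "\<dots> = real n * m + (\<Sum>k<N. r k) / 2" by (simp add: sum_divide_distrib)
    finally show ?thesis by simp
  qed
  have "(\<Sum>k. u k) = (SUP N. \<Sum>k<N. u k)" by (rule suminf_eq_SUP)
  also have "\<dots> \<le> ennreal (2 * real n * m)"
  proof (rule SUP_least)
    fix N show "(\<Sum>k<N. u k) \<le> ennreal (2 * real n * m)"
      unfolding u using bound[of N] r0 by (subst sum_ennreal) (auto intro: ennreal_leI)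
  qed
  finally show ?thesis .
qed

text \<open>
  This includes N = \<infinity>, where all terms are present and the series diverges.
\<close>

lemma le_dyadic_suminf:
  fixes N :: ennreal
  assumes l: "0 < l"
  shows "N \<le> ennreal l + (\<Sum>k. if ennreal (2 ^ k * l) < N then ennreal (2 ^ k * l) else 0)"
    (is "N \<le> ennreal l + (\<Sum>k. ?u k)")
proof -
  have part: "ennreal (2 ^ m * l) \<le> ennreal l + (\<Sum>k. ?u k)" if "\<And>k. k < m \<Longrightarrow> ennreal (2 ^ k * l) < N" for m
  proof -
    have "ennreal (2 ^ m * l) = ennreal l + (\<Sum>k<m. ennreal (2 ^ k * l))"
    proof (induction m)
      case (Suc m)
      have "ennreal (2 ^ Suc m * l) = ennreal (2 ^ m * l) + ennreal (2 ^ m * l)"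
        using l by (subst ennreal_plus[symmetric]) auto
      then show ?case using Suc by (simp add: ac_simps)
    qed simp
    also have "(\<Sum>k<m. ennreal (2 ^ k * l)) = (\<Sum>k<m. ?u k)" using that by (intro sum.cong) auto
    also have "ennreal l + \<dots> \<le> ennreal l + (\<Sum>k. ?u k)"
      by (intro add_left_mono sum_le_suminf) auto
    finally show ?thesis .
  qed
  show ?thesis
  proof (cases "\<exists>m. N \<le> ennreal (2 ^ m * l)")
    case True
    define m where "m = (LEAST m. N \<le> ennreal (2 ^ m * l))"
    have "N \<le> ennreal (2 ^ m * l)" unfolding m_def using True by (rule LeastI_ex)
    also have "\<dots> \<le> ennreal l + (\<Sum>k. ?u k)"
      using not_less_Least[of _ "\<lambda>m. N \<le> ennreal (2 ^ m * l)"]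
      by (intro part) (auto simp: m_def not_le)
    finally show ?thesis .
  next
    case False
    have "ennreal l + (\<Sum>k. ?u k) = top"
    proof (rule ccontr)
      assume "ennreal l + (\<Sum>k. ?u k) \<noteq> top"
      then obtain s where s: "ennreal l + (\<Sum>k. ?u k) = ennreal s" "0 \<le> s"
        by (cases "ennreal l + (\<Sum>k. ?u k)") auto
      obtain m where "s / l < 2 ^ m" using real_arch_pow[of 2 "s / l"] by auto
      then have "s < 2 ^ m * l" using l by (simp add: pos_divide_less_eq)
      then show False using part[of m] False s by (auto simp: not_le)
    qed
    then show ?thesis by simp
  qed
qed

text \<open>
  The layer cake in the converse direction: the integral of the maximal function is at most the
  contribution of the base height l plus the sum of the masses of all dyadic level sets, which is
  comparable to n times the largest mass when the masses halve every n steps. The gap (b,c) supplies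
  a point t at which the base height is not exceeded, so that no component leaves (a,t).
\<close>

lemma left_max_integral_local_le:
  assumes w: "weight w" and e: "0 < e" "e < 1"
    and taub: "tauberian_plus w (1 - e) - 1 \<le> ennreal (1 / 4)" and n: "4 < e * 2 ^ n"
    and abc: "a < b" "b < c"
  shows "(\<integral>\<^sup>+x\<in>{a<..<b}. left_max w a x \<partial>lebesgue)
    \<le> ennreal ((c - a) / (c - b) + 2 * real n) * wmass w {a..c}"
proof (cases "wmass w {a..c} = 0")
  case True
  have "(\<integral>\<^sup>+x\<in>{a<..<b}. left_max w a x \<partial>lebesgue) = (\<integral>\<^sup>+(x::real). 0 \<partial>lebesgue)"
    using abc by (intro nn_integral_cong) (auto simp: indicator_def left_max_zero_mass[OF True])
  then show ?thesis by simp
next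
  case False
  obtain m where m: "wmass w {a..c} = ennreal m" "0 \<le> m"
    using wmass_Icc_finite[OF w, of a c] by (cases "wmass w {a..c}") auto
  then have m0: "0 < m" using False by (cases "m = 0") auto
  define l where "l = m / (c - b)"
  have l: "0 < l" "l * (c - b) = m" using m0 abc by (auto simp: l_def)
  obtain t where t: "b \<le> t" "t \<le> c" "left_max w a t \<le> ennreal l"
    using exists_left_max_le[OF w abc less_imp_le[OF l(1)]] l m by auto
  have at: "a < t" using t abc by auto
  let ?O = "\<lambda>k. level_set w a t (2 ^ k * l)"
  have lk: "0 \<le> 2 ^ k * l" "0 < 2 ^ k * l" "l \<le> 2 ^ k * l" for k :: nat
    using l mult_right_mono[of 1 "2 ^ k" l] by auto
  have tk: "left_max w a t \<le> ennreal (2 ^ k * l)" for k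
    by (rule order_trans[OF t(3) ennreal_leI[OF lk(3)]])
  have op: "open (?O k)" for k by (rule open_level_set[OF w lk(1)])
  have "(\<integral>\<^sup>+x\<in>{a<..<b}. left_max w a x \<partial>lebesgue)
      \<le> (\<integral>\<^sup>+x. ennreal l * indicator {a<..<t} x + (\<Sum>k. ennreal (2 ^ k * l) * indicator (?O k) x) \<partial>lebesgue)"
  proof (rule nn_integral_mono)
    fix x :: real
    show "left_max w a x * indicator {a<..<b} x
        \<le> ennreal l * indicator {a<..<t} x + (\<Sum>k. ennreal (2 ^ k * l) * indicator (?O k) x)"
    proof (cases "x \<in> {a<..<b}")
      case True
      then have x: "x \<in> {a<..<t}" using t by auto
      then have "(\<Sum>k. ennreal (2 ^ k * l) * indicator (?O k) x)
          = (\<Sum>k. if ennreal (2 ^ k * l) < left_max w a x then ennreal (2 ^ k * l) else 0)"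
        by (intro suminf_cong) (auto simp: level_set_def)
      then show ?thesis using le_dyadic_suminf[OF l(1), of "left_max w a x"] True x by simp
    qed simp
  qed
  also have "\<dots> = (\<integral>\<^sup>+x. ennreal l * indicator {a<..<t} x \<partial>lebesgue)
      + (\<integral>\<^sup>+x. (\<Sum>k. ennreal (2 ^ k * l) * indicator (?O k) x) \<partial>lebesgue)"
    using op by (intro nn_integral_add borel_measurable_suminf_order
        borel_measurable_times_ennreal borel_measurable_indicator) auto
  also have "(\<integral>\<^sup>+x. (\<Sum>k. ennreal (2 ^ k * l) * indicator (?O k) x) \<partial>lebesgue)
      = (\<Sum>k. \<integral>\<^sup>+x. ennreal (2 ^ k * l) * indicator (?O k) x \<partial>lebesgue)"
    using op by (intro nn_integral_suminf borel_measurable_times_ennreal borel_measurable_indicator) auto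
  also have "\<dots> = (\<Sum>k. wmass w (?O k))"
    using op by (simp add: nn_integral_cmult_indicator wmass_level_set[OF w lk(1) at tk])
  also have "\<dots> \<le> ennreal (2 * real n * m)"
  proof (rule suminf_le_of_periodic_halving[OF _ m(2)])
    fix k
    show "wmass w (?O k) \<le> ennreal m"
      unfolding m(1)[symmetric] using t by (intro wmass_mono) (auto simp: level_set_def)
    have "2 ^ (n + k) * l = 2 ^ n * (2 ^ k * l)" by (simp add: power_add)
    then show "wmass w (?O (n + k)) \<le> ennreal (1 / 2) * wmass w (?O k)"
      using level_set_halving_of_tauberian[OF w e taub n lk(2) at tk] by (simp only:)
  qed
  also have "(\<integral>\<^sup>+x. ennreal l * indicator {a<..<t} x \<partial>lebesgue) = ennreal (l * (t - a))"
    using at l by (simp add: nn_integral_cmult_indicator ennreal_mult)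
  also have "ennreal (l * (t - a)) + ennreal (2 * real n * m) = ennreal (l * (t - a) + 2 * real n * m)"
    using at l m by (subst ennreal_plus) auto
  also have "\<dots> \<le> ennreal (((c - a) / (c - b) + 2 * real n) * m)"
  proof (rule ennreal_leI)
    have "l * (t - a) \<le> l * (c - a)" using l t by simp
    also have "\<dots> = (c - a) / (c - b) * m" by (simp add: l_def)
    finally show "l * (t - a) + 2 * real n * m \<le> ((c - a) / (c - b) + 2 * real n) * m"
      by (simp add: algebra_simps)
  qed
  also have "\<dots> = ennreal ((c - a) / (c - b) + 2 * real n) * wmass w {a..c}"
    using m abc by (simp add: ennreal_mult)
  finally show ?thesis by (simp add: add_left_mono)
qed

section \<open>Averages over long intervals and the Hardy operator\<close>

lemma sigma_finite_lebesgue: "sigma_finite_measure (lebesgue :: real measure)"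
proof
  show "\<exists>A::real set set. countable A \<and> A \<subseteq> sets lebesgue \<and> \<Union> A = space lebesgue
      \<and> (\<forall>a\<in>A. emeasure lebesgue a \<noteq> \<infinity>)"
  proof (intro exI[of _ "range (\<lambda>n::nat. {- real n..real n})"] conjI ballI)
    show "\<Union> (range (\<lambda>n::nat. {- real n..real n})) = space lebesgue"
    proof (intro equalityI subsetI)
      fix x :: real
      obtain n :: nat where "\<bar>x\<bar> \<le> real n" using real_arch_simple by blast
      then have "x \<in> {- real n..real n}" by auto
      then show "x \<in> \<Union> (range (\<lambda>n::nat. {- real n..real n}))" by blast
    qed simp
  qed auto
qed

text \<open>
  The integral of w(t)/(b - t) over (a,x), which is the adjoint of the Hardy averages over (t,b).
\<close>

definition dual_hardy :: "(real \<Rightarrow> real) \<Rightarrow> real \<Rightarrow> real \<Rightarrow> real \<Rightarrow> ennreal" where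
  "dual_hardy w a b x = (\<integral>\<^sup>+t. (if a < t \<and> t < x \<and> x < b then ennreal (w t / (b - t)) else 0) \<partial>lebesgue)"

lemma dual_hardy_measurable_kernel:
  assumes w: "weight w"
  shows "(\<lambda>(t, x). if a < t \<and> t < x \<and> x < b then ennreal (w t / (b - t)) else 0)
    \<in> borel_measurable (lebesgue \<Otimes>\<^sub>M lebesgue)"
proof -
  have [measurable]: "(\<lambda>x::real. x) \<in> borel_measurable lebesgue"
    using measurable_completion[of "\<lambda>x::real. x" lborel borel] by simp
  have [measurable]: "w \<in> borel_measurable lebesgue" by (rule weight_borel_measurable[OF w])
  have [measurable]: "fst \<in> borel_measurable (lebesgue \<Otimes>\<^sub>M (lebesgue :: real measure) :: (real \<times> real) measure)"
    by (rule measurable_compose[OF measurable_fst, of "\<lambda>x. x"]) measurable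
  have [measurable]: "snd \<in> borel_measurable ((lebesgue :: real measure) \<Otimes>\<^sub>M lebesgue :: (real \<times> real) measure)"
    by (rule measurable_compose[OF measurable_snd, of "\<lambda>x. x"]) measurable
  have [measurable]: "(\<lambda>p. w (fst p)) \<in> borel_measurable (lebesgue \<Otimes>\<^sub>M (lebesgue :: real measure))"
    by (rule measurable_compose[OF measurable_fst, of w]) measurable
  show ?thesis unfolding case_prod_beta by measurable
qed

lemma dual_hardy_measurable:
  assumes w: "weight w"
  shows "dual_hardy w a b \<in> borel_measurable lebesgue"
proof -
  interpret sigma_finite_measure "lebesgue :: real measure" by (rule sigma_finite_lebesgue)
  have "(\<lambda>(x, t). if a < t \<and> t < x \<and> x < b then ennreal (w t / (b - t)) else 0)
      \<in> borel_measurable (lebesgue \<Otimes>\<^sub>M lebesgue)"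
    using measurable_compose[OF measurable_pair_swap' dual_hardy_measurable_kernel[OF w, of a b]]
    by (simp add: case_prod_unfold cong: if_cong)
  then show ?thesis unfolding dual_hardy_def
    by (rule borel_measurable_nn_integral[of "\<lambda>x t. if a < t \<and> t < x \<and> x < b then ennreal (w t / (b - t)) else 0"])
qed

text \<open>
  Exchanging the integrals, t is seen by the points x in (t,b), whose total length cancels the
  denominator.
\<close>

lemma integral_dual_hardy:
  assumes w: "weight w" and ab: "a < b"
  shows "(\<integral>\<^sup>+x. dual_hardy w a b x \<partial>lebesgue) = wmass w {a..b}"
proof -
  interpret pair_sigma_finite "lebesgue :: real measure" "lebesgue :: real measure"
    by (intro pair_sigma_finite.intro sigma_finite_lebesgue)
  have nn: "0 \<le> w t" for t using w by (auto simp: weight_def)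
  have "(\<integral>\<^sup>+x. dual_hardy w a b x \<partial>lebesgue)
      = (\<integral>\<^sup>+t. (\<integral>\<^sup>+x. (if a < t \<and> t < x \<and> x < b then ennreal (w t / (b - t)) else 0) \<partial>lebesgue) \<partial>lebesgue)"
    unfolding dual_hardy_def by (rule Fubini'[OF dual_hardy_measurable_kernel[OF w]])
  also have "\<dots> = (\<integral>\<^sup>+t\<in>{a<..<b}. ennreal (w t) \<partial>lebesgue)"
  proof (rule nn_integral_cong)
    fix t :: real
    show "(\<integral>\<^sup>+x. (if a < t \<and> t < x \<and> x < b then ennreal (w t / (b - t)) else 0) \<partial>lebesgue)
        = ennreal (w t) * indicator {a<..<b} t"
    proof (cases "t \<in> {a<..<b}")
      case True
      then have "(\<integral>\<^sup>+x. (if a < t \<and> t < x \<and> x < b then ennreal (w t / (b - t)) else 0) \<partial>lebesgue)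
          = (\<integral>\<^sup>+x. ennreal (w t / (b - t)) * indicator {t<..<b} x \<partial>lebesgue)"
        by (intro nn_integral_cong) (auto simp: indicator_def)
      also have "\<dots> = ennreal (w t / (b - t)) * ennreal (b - t)"
        using True by (simp add: nn_integral_cmult_indicator)
      also have "\<dots> = ennreal (w t)"
        using True nn[of t] by (simp add: ennreal_mult[symmetric])
      finally show ?thesis using True by simp
    next
      case False
      then have "(\<integral>\<^sup>+x. (if a < t \<and> t < x \<and> x < b then ennreal (w t / (b - t)) else 0) \<partial>lebesgue)
          = (\<integral>\<^sup>+(x::real). 0 \<partial>lebesgue)"
        by (intro nn_integral_cong) auto
      then show ?thesis using False by simp
    qed
  qed
  also have "\<dots> = wmass w {a..b}" by (simp add: wmass_def[symmetric] wmass_interval_eq)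
  finally show ?thesis .
qed

text \<open>
  For t in (y,x) the kernel 1/(b - t) is at least 1/(b - y), and b - y is at most twice the length
  of (y,x).
\<close>

lemma far_average_le_dual_hardy:
  assumes w: "weight w" and y: "a \<le> y" "y < x" "x < b" and far: "b - x \<le> x - y"
  shows "wmass w {y..x} / ennreal (x - y) \<le> 2 * dual_hardy w a b x"
proof -
  have nn: "0 \<le> w t" for t using w by (auto simp: weight_def)
  have "ennreal (1 / (b - y)) * wmass w {y..x} = ennreal (1 / (b - y)) * wmass w {y<..<x}"
    by (simp add: wmass_interval_eq)
  also have "\<dots> = (\<integral>\<^sup>+t. ennreal (1 / (b - y)) * (ennreal (w t) * indicator {y<..<x} t) \<partial>lebesgue)"
    unfolding wmass_def using weight_measurable_ennreal[OF w]
    by (intro nn_integral_cmult[symmetric] borel_measurable_times_ennreal borel_measurable_indicator) auto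
  also have "\<dots> \<le> dual_hardy w a b x"
    unfolding dual_hardy_def
  proof (rule nn_integral_mono)
    fix t :: real
    show "ennreal (1 / (b - y)) * (ennreal (w t) * indicator {y<..<x} t)
        \<le> (if a < t \<and> t < x \<and> x < b then ennreal (w t / (b - t)) else 0)"
    proof (cases "t \<in> {y<..<x}")
      case True
      then have "1 / (b - y) * w t \<le> w t / (b - t)"
        using nn[of t] y by (simp add: frac_le)
      then have "ennreal (1 / (b - y)) * ennreal (w t) \<le> ennreal (w t / (b - t))"
        using y nn[of t] by (subst ennreal_mult[symmetric]) (auto intro: ennreal_leI)
      then show ?thesis using True y by simp
    qed simp
  qed
  finally have le: "ennreal (1 / (b - y)) * wmass w {y..x} \<le> dual_hardy w a b x" .
  have "wmass w {y..x} / ennreal (x - y) = ennreal (1 / (x - y)) * wmass w {y..x}"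
    using y by (simp add: divide_ennreal_def mult.commute inverse_ennreal inverse_eq_divide)
  also have "\<dots> \<le> ennreal (2 * (1 / (b - y))) * wmass w {y..x}"
    using y far by (intro mult_right_mono ennreal_leI) (auto simp: field_simps)
  also have "\<dots> = 2 * (ennreal (1 / (b - y)) * wmass w {y..x})"
    using y by (subst ennreal_mult) (auto simp: mult.assoc)
  also have "\<dots> \<le> 2 * dual_hardy w a b x" using le by (rule mult_left_mono) simp
  finally show ?thesis .
qed

text \<open>
  An average over (y,x) either starts in the Whitney interval of x or in the preceding one, or it reaches
  so far back that it is controlled by the Hardy operator.
\<close>

lemma left_max_le_near_plus_far:
  assumes w: "weight w" and ab: "a < b"
    and x: "x \<in> {whitney_point a b k<..<whitney_point a b (Suc k)}"
  shows "left_max w a x \<le> 2 * dual_hardy w a b x + left_max w (whitney_point a b (k - 1)) x"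
  unfolding left_max_def[of w a x]
proof (rule SUP_least)
  fix y assume y: "y \<in> {a..<x}"
  have xb: "x < b" using x whitney_point_bounds[OF ab, of "Suc k"] by auto
  show "wmass w {y..x} / ennreal (x - y)
      \<le> 2 * dual_hardy w a b x + left_max w (whitney_point a b (k - 1)) x"
  proof (cases "whitney_point a b (k - 1) \<le> y")
    case True
    then have "wmass w {y..x} / ennreal (x - y) \<le> left_max w (whitney_point a b (k - 1)) x"
      unfolding left_max_def using y by (intro SUP_upper) auto
    then show ?thesis by (simp add: add_increasing)
  next
    case False
    then have "0 < k" using y by (cases k) auto
    then have "b - whitney_point a b (k - 1) = 2 * (b - whitney_point a b k)"
      by (cases k) (auto simp: whitney_point_def field_simps)
    then have "b - x \<le> x - y" using False x by auto
    then have "wmass w {y..x} / ennreal (x - y) \<le> 2 * dual_hardy w a b x"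
      using y xb by (intro far_average_le_dual_hardy[OF w]) auto
    then show ?thesis by (simp add: add_increasing2)
  qed
qed

text \<open>
  The local bound on a Whitney interval needs the next one as gap, which exists at every scale up to b;
  the averages it misses contribute at most twice the mass of (a,b) through the Hardy operator.
\<close>

lemma left_max_integral_le:
  assumes w: "weight w" and e: "0 < e" "e < 1"
    and taub: "tauberian_plus w (1 - e) - 1 \<le> ennreal (1 / 4)" and n: "4 < e * 2 ^ n"
    and ab: "a < b"
  shows "(\<integral>\<^sup>+x\<in>{a<..<b}. left_max w a x \<partial>lebesgue) \<le> ennreal (23 + 6 * real n) * wmass w {a..b}"
proof -
  let ?x = "whitney_point a b"
  let ?H = "\<lambda>x. 2 * dual_hardy w a b x"
  let ?N = "\<lambda>x. left_max w a x * indicator {a<..<b} x"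
  \<comment> \<open>The case distinction matters at points where both terms are infinite: there the plain difference would be infinite.\<close>
  define g where "g x = (if ?N x \<le> ?H x then 0 else ?N x - ?H x)" for x
  have Hm: "?H \<in> borel_measurable lebesgue"
    by (intro borel_measurable_times_ennreal dual_hardy_measurable[OF w]) simp
  have gm: "g \<in> borel_measurable lebesgue"
    unfolding g_def
    by (intro measurable_If borel_measurable_minus_ennreal borel_measurable_le left_max_measurable[OF w] Hm) simp
  have near: "(\<integral>\<^sup>+x\<in>{a..<b}. g x \<partial>lebesgue)
      \<le> 3 * ennreal (7 + 2 * real n) * (\<integral>\<^sup>+x\<in>{a..<b}. ennreal (w x) \<partial>lebesgue)"
  proof (rule set_nn_integral_le_by_whitney[OF ab gm weight_measurable_ennreal[OF w]])
    fix k
    have ord: "?x k < ?x (Suc k)" "?x (Suc k) < ?x (k + 2)" "?x (k - 1) \<le> ?x k"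
      using ab by (auto intro: whitney_point_less whitney_point_le)
    have ratio: "(?x (k + 2) - ?x (k - 1)) / (?x (k + 2) - ?x (Suc k)) \<le> 7"
      using ab by (cases k) (auto simp: whitney_point_def field_simps)
    have "(\<integral>\<^sup>+x\<in>{?x k..<?x (Suc k)}. g x \<partial>lebesgue) = (\<integral>\<^sup>+x\<in>{?x k<..<?x (Suc k)}. g x \<partial>lebesgue)"
      by (rule set_nn_integral_cong_endpoints[of _ "?x k" "?x k"]) auto
    also have "\<dots> \<le> (\<integral>\<^sup>+x\<in>{?x (k - 1)<..<?x (Suc k)}. left_max w (?x (k - 1)) x \<partial>lebesgue)"
    proof (rule nn_integral_mono)
      fix x :: real
      show "g x * indicator {?x k<..<?x (Suc k)} x
          \<le> left_max w (?x (k - 1)) x * indicator {?x (k - 1)<..<?x (Suc k)} x"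
      proof (cases "x \<in> {?x k<..<?x (Suc k)}")
        case True
        then have "x \<in> {?x (k - 1)<..<?x (Suc k)}" using ord by auto
        moreover have "g x \<le> left_max w (?x (k - 1)) x"
        proof (cases "?N x \<le> ?H x")
          case False
          then have "?H x \<noteq> top" by (metis top_greatest)
          moreover have "?N x \<le> ?H x + left_max w (?x (k - 1)) x"
            using left_max_le_near_plus_far[OF w ab True]
            by (rule order_trans[rotated]) (auto simp: indicator_def)
          ultimately show ?thesis using False by (simp add: g_def ennreal_minus_le_iff)
        qed (simp add: g_def)
        ultimately show ?thesis using True by (auto intro: order_trans)
      qed simp
    qed
    also have "\<dots> \<le> ennreal ((?x (k + 2) - ?x (k - 1)) / (?x (k + 2) - ?x (Suc k)) + 2 * real n)
        * wmass w {?x (k - 1)..?x (k + 2)}"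
      using ord by (intro left_max_integral_local_le[OF w e taub n]) auto
    also have "\<dots> \<le> ennreal (7 + 2 * real n) * wmass w {?x (k - 1)..<?x (k + 2)}"
      unfolding wmass_interval_eq using ratio by (intro mult_right_mono ennreal_leI) auto
    finally show "(\<integral>\<^sup>+x\<in>{?x k..<?x (Suc k)}. g x \<partial>lebesgue)
        \<le> ennreal (7 + 2 * real n) * (\<integral>\<^sup>+x\<in>{?x (k - 1)..<?x (k + 2)}. ennreal (w x) \<partial>lebesgue)"
      by (simp add: wmass_def)
  qed
  have "(\<integral>\<^sup>+x\<in>{a<..<b}. left_max w a x \<partial>lebesgue)
      \<le> (\<integral>\<^sup>+x. g x * indicator {a..<b} x + ?H x \<partial>lebesgue)"
  proof (rule nn_integral_mono)
    fix x :: real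
    show "?N x \<le> g x * indicator {a..<b} x + ?H x"
    proof (cases "x \<in> {a<..<b} \<and> ?H x < ?N x")
      case True
      then have "?N x = (?N x - ?H x) + ?H x" by (intro diff_add_cancel_ennreal[symmetric] less_imp_le) auto
      then show ?thesis using True by (simp add: g_def not_le)
    next
      case False
      then show ?thesis by (cases "x \<in> {a<..<b}") (auto simp: not_less intro: order_trans)
    qed
  qed
  also have "\<dots> = (\<integral>\<^sup>+x\<in>{a..<b}. g x \<partial>lebesgue) + (\<integral>\<^sup>+x. ?H x \<partial>lebesgue)"
    using gm Hm by (intro nn_integral_add Hm borel_measurable_times_ennreal[OF gm] borel_measurable_indicator) auto
  also have "(\<integral>\<^sup>+x. ?H x \<partial>lebesgue) = 2 * wmass w {a..b}"
    using integral_dual_hardy[OF w ab] dual_hardy_measurable[OF w] by (simp add: nn_integral_cmult)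
  also have "(\<integral>\<^sup>+x\<in>{a..<b}. g x \<partial>lebesgue) \<le> 3 * ennreal (7 + 2 * real n) * wmass w {a..b}"
    using near by (simp only: wmass_def[symmetric] wmass_interval_eq)
  also have "3 * ennreal (7 + 2 * real n) * wmass w {a..b} + 2 * wmass w {a..b}
      = (3 * ennreal (7 + 2 * real n) + 2) * wmass w {a..b}"
    by (simp only: distrib_right)
  also have "3 * ennreal (7 + 2 * real n) + 2 = ennreal (23 + 6 * real n)"
  proof -
    have "3 * ennreal (7 + 2 * real n) + 2 = ennreal 3 * ennreal (7 + 2 * real n) + ennreal 2" by simp
    also have "\<dots> = ennreal (3 * (7 + 2 * real n) + 2)"
      by (subst ennreal_mult[symmetric], simp, simp, subst ennreal_plus[symmetric]) auto
    finally show ?thesis by (simp add: algebra_simps)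
  qed
  finally show ?thesis by (simp add: add_right_mono)
qed

section \<open>Equivalence of the two conditions\<close>

text \<open>
  At \<alpha> = 1 - e with e = exp(-\<kappa> \<beta>) the hypothesis says that the tauberian constant
  exceeds 1 by at most 1/4. The number n of dyadic steps in which the level sets halve is then comparable to log(1/e), hence to \<beta>.
\<close>

lemma Ainf_of_tauberian_plus_le:
  assumes K: "0 < K" and w: "weight w" and \<beta>: "1 < \<beta>"
    and taub: "\<And>\<alpha>. \<alpha> < 1 \<Longrightarrow> 1 - exp (- \<beta>) < \<alpha> \<Longrightarrow>
      tauberian_plus w \<alpha> - 1 \<le> ennreal (K * (1 - \<alpha>) powr (1 / \<beta>))"
  shows "Ainf_plus_const w \<le> ennreal ((59 + 12 * ln (4 * K + 1)) * \<beta>)"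
proof -
  \<comment> \<open>This makes \<kappa> exceed 1, so that 1 - e is admissible, and makes exp \<kappa> at least 4 K.\<close>
  define \<kappa> where "\<kappa> = 1 + ln (4 * K + 1)"
  have \<kappa>: "1 < \<kappa>" using K by (simp add: \<kappa>_def)
  have \<kappa>\<beta>: "\<beta> < \<kappa> * \<beta>" using \<kappa> \<beta> by simp
  define e where "e = exp (- (\<kappa> * \<beta>))"
  have e: "0 < e" "e < 1" "e < exp (- \<beta>)" using \<kappa>\<beta> \<beta> by (auto simp: e_def)
  have "K * e powr (1 / \<beta>) = K * exp (- \<kappa>)" using \<beta> by (simp add: e_def powr_def)
  also have "\<dots> \<le> 1 / 4"
  proof -
    have "4 * K \<le> exp 1 * (4 * K + 1)"
      using K mult_mono[of 1 "exp 1" "4 * K" "4 * K + 1"] by simp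
    also have "\<dots> = exp \<kappa>" using K by (simp add: \<kappa>_def exp_add)
    finally show ?thesis by (simp add: exp_minus field_simps)
  qed
  finally have "K * (1 - (1 - e)) powr (1 / \<beta>) \<le> 1 / 4" by simp
  then have quarter: "tauberian_plus w (1 - e) - 1 \<le> ennreal (1 / 4)"
    using taub[of "1 - e"] e by (meson diff_strict_left_mono diff_less_eq ennreal_leI less_add_same_cancel1 order_trans)
  \<comment> \<open>As ln 2 is at least 1/2, this n gives n ln 2 above \<kappa> \<beta> + ln 4.\<close>
  define n where "n = nat \<lceil>2 * (\<kappa> * \<beta>) + 3\<rceil>"
  have n: "2 * (\<kappa> * \<beta>) + 3 \<le> real n" "real n \<le> 2 * (\<kappa> * \<beta>) + 4"
    using \<kappa>\<beta> \<beta> unfolding n_def by linarith+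
  have "4 < e * 2 ^ n"
  proof -
    have "\<kappa> * \<beta> + ln 4 < real n * ln 2"
    proof -
      have "ln 4 = 2 * ln (2::real)" using ln_realpow[of 2 2] by simp
      moreover have "(2 * (\<kappa> * \<beta>) + 3) * ln 2 \<le> real n * ln 2" using n by (intro mult_right_mono) auto
      moreover have "(2 * (\<kappa> * \<beta>)) * (1 / 2) \<le> (2 * (\<kappa> * \<beta>)) * ln 2"
        using \<kappa>\<beta> \<beta> ln2_ge_two_thirds by (intro mult_left_mono) auto
      moreover have "0 < ln (2::real)" by simp
      ultimately show ?thesis unfolding distrib_right by linarith
    qed
    then have "ln 4 < - (\<kappa> * \<beta>) + real n * ln 2" by simp
    then have "exp (ln 4) < exp (- (\<kappa> * \<beta>) + real n * ln 2)" by (subst exp_less_cancel_iff)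
    also have "\<dots> = e * 2 ^ n" by (simp add: e_def exp_add exp_diff exp_minus exp_of_nat_mult field_simps)
    finally show ?thesis by simp
  qed
  then have "Ainf_plus_const w \<le> ennreal (23 + 6 * real n)"
    using left_max_integral_le[OF w e(1,2) quarter] by (intro Ainf_plus_const_leI[OF w])
  also have "\<dots> \<le> ennreal ((59 + 12 * ln (4 * K + 1)) * \<beta>)"
  proof (rule ennreal_leI)
    have "23 + 6 * real n \<le> 47 + 12 * (\<kappa> * \<beta>)" using n by simp
    also have "\<dots> \<le> 47 * \<beta> + 12 * (\<kappa> * \<beta>)" using \<beta> by simp
    also have "\<dots> = (59 + 12 * ln (4 * K + 1)) * \<beta>" by (simp add: \<kappa>_def algebra_simps)
    finally show "23 + 6 * real n \<le> (59 + 12 * ln (4 * K + 1)) * \<beta>" .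
  qed
  finally show ?thesis .
qed

(* Subtraction on ennreal truncates at 0, which is harmless here: in every inequality
   "tauberian_plus w \<alpha> - 1 \<le> r" below, r is non-negative. *)
theorem corollary1p2:
  shows "(\<exists>c C :: real. c > 0 \<and> C > 0 \<and>
      (\<forall>w \<in> Ainf_plus. \<not> (AE x in lebesgue. w x = 0) \<longrightarrow>
        (\<forall>\<alpha>::real. 1 > \<alpha> \<and> \<alpha> > 1 - exp (- (c * enn2real (Ainf_plus_const w))) \<longrightarrow>
          tauberian_plus w \<alpha> - 1
            \<le> ennreal (C * (1 - \<alpha>) powr (inverse (c * enn2real (Ainf_plus_const w)))))))
    \<and> (\<forall>K::real. K > 0 \<longrightarrow>
        (\<exists>C\<^sub>K::real. C\<^sub>K > 0 \<and>
          (\<forall>(w :: real \<Rightarrow> real) (\<beta> :: real).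
            weight w \<and> \<beta> > 1 \<and>
            (\<forall>\<alpha>::real. 1 > \<alpha> \<and> \<alpha> > 1 - exp (- \<beta>) \<longrightarrow>
              tauberian_plus w \<alpha> - 1 \<le> ennreal (K * (1 - \<alpha>) powr (1 / \<beta>)))
            \<longrightarrow> w \<in> Ainf_plus \<and> Ainf_plus_const w \<le> ennreal (C\<^sub>K * \<beta>))))"
proof (intro conjI allI impI)
  show "\<exists>c C :: real. c > 0 \<and> C > 0 \<and>
      (\<forall>w \<in> Ainf_plus. \<not> (AE x in lebesgue. w x = 0) \<longrightarrow>
        (\<forall>\<alpha>::real. 1 > \<alpha> \<and> \<alpha> > 1 - exp (- (c * enn2real (Ainf_plus_const w))) \<longrightarrow>
          tauberian_plus w \<alpha> - 1
            \<le> ennreal (C * (1 - \<alpha>) powr (inverse (c * enn2real (Ainf_plus_const w))))))"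
    using tauberian_plus_le_of_Ainf by (intro exI[of _ 40] exI[of _ 36]) auto
next
  fix K :: real assume K: "K > 0"
  show "\<exists>C\<^sub>K::real. C\<^sub>K > 0 \<and>
      (\<forall>(w :: real \<Rightarrow> real) (\<beta> :: real).
        weight w \<and> \<beta> > 1 \<and>
        (\<forall>\<alpha>::real. 1 > \<alpha> \<and> \<alpha> > 1 - exp (- \<beta>) \<longrightarrow>
          tauberian_plus w \<alpha> - 1 \<le> ennreal (K * (1 - \<alpha>) powr (1 / \<beta>)))
        \<longrightarrow> w \<in> Ainf_plus \<and> Ainf_plus_const w \<le> ennreal (C\<^sub>K * \<beta>))"
  proof (intro exI[of _ "59 + 12 * ln (4 * K + 1)"] conjI allI impI)
    show "0 < 59 + 12 * ln (4 * K + 1)" using K by (simp add: add_pos_nonneg)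
    fix w \<beta>
    assume *: "weight w \<and> \<beta> > 1 \<and>
        (\<forall>\<alpha>::real. 1 > \<alpha> \<and> \<alpha> > 1 - exp (- \<beta>) \<longrightarrow>
          tauberian_plus w \<alpha> - 1 \<le> ennreal (K * (1 - \<alpha>) powr (1 / \<beta>)))"
    then show le: "Ainf_plus_const w \<le> ennreal ((59 + 12 * ln (4 * K + 1)) * \<beta>)"
      using K by (intro Ainf_of_tauberian_plus_le) auto
    then have "Ainf_plus_const w < \<infinity>" by (rule le_less_trans) simp
    then show "w \<in> Ainf_plus" using * by (simp add: Ainf_plus_def)
  qed
qed

end
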